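(* Let $T\in\mathcal{B}(\mathcal{H})$. Then $T$ is $n$-finite, with $$[T^*,T]=\sum_{j=1}^n\alpha_j\, e_j\otimes e_j,$$ for some orthonormal set $\{e_j\}_{j=1}^n\subseteq\mathcal{D}_{T^*}\ominus\mathcal{D}_T$ and scalars $\{\alpha_j\}_{j=1}^n\subseteq(0,1]$, if and only if $T\cong X_1$ or $T\cong X_2$, where $$X_1=\begin{bmatrix} M_z\otimes I&0\\0&N\end{bmatrix}\in\mathcal{B}\big((H^2(\mathbb{D})\otimes\mathbb{C}^n)\oplus\mathcal{H}_0\big),$$ and $$X_2=\begin{bmatrix} M_z\otimes I&P_{\mathbb{C}}\otimes\tilde{D}_{\{\alpha_i\}_{i=1}^m}&0\\0&M_z^*\otimes D_{\{\alpha_i\}_{i=1}^m}&0\\0&0&N\end{bmatrix}\in\mathcal{B}\big((H^2(\mathbb{D})\otimes\mathbb{C}^n)\oplus(H^2(\mathbb{D})\otimes\mathbb{C}^m)\oplus\mathcal{H}_0\big),$$ and $N$ is a normal operator acting on a closed subspace $\mathcal{H}_0\subseteq\mathcal{H}$.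
   Context: $\mathcal{H}$ is a separable complex Hilbert space, $\mathcal{B}(\mathcal{H})$ is the space of bounded linear operators on $\mathcal{H}$, $n\in\mathbb{N}$, and $\cong$ denotes unitary equivalence. For $T\in\mathcal{B}(\mathcal{H})$, $[T^*,T]=T^*T-TT^*$; $T$ is hyponormal if $[T^*,T]\ge0$, and a contraction if $\|Th\|\le\|h\|$ for all $h\in\mathcal{H}$. For a contraction $T$, put $D_T=(I-T^*T)^{1/2}$ and $D_{T^*}=(I-TT^* )^{1/2}$, and let $\mathcal{D}_T$, $\mathcal{D}_{T^*}$ be the closures of the ranges of $D_T$, $D_{T^*}$. If $T$ is a hyponormal contraction then $\mathcal{D}_T\subseteq\mathcal{D}_{T^*}$, and $\mathcal{D}_{T^*}\ominus\mathcal{D}_T$ denotes the orthogonal complement of $\mathcal{D}_T$ in $\mathcal{D}_{T^*}$. $T$ is $n$-finite if $T$ is a hyponormal contraction, $\operatorname{rank}[T^*,T]=n$, and $\operatorname{ran}[T^*,T]\subseteq\mathcal{D}_{T^*}\ominus\mathcal{D}_T$. For $u,v\in\mathcal{H}$, $u\otimes v$ is the rank-one operator $(u\otimes v)h=\langle h,v\rangle u$. $H^2(\mathbb{D})$ is the Hardy space of analytic functions on the open unit disc $\mathbb{D}$ with square-summable power series coefficients, $M_z$ is multiplication by $z$ on it, and $P_{\mathbb{C}}$ is the orthogonal projection of $H^2(\mathbb{D})$ onto the subspace of constant functions. In $X_1$ and $X_2$, $I$ in $M_z\otimes I$ is the identity on $\mathbb{C}^n$. For a natural number $m$ and $\{\alpha_i\}_{i=1}^m\subseteq(0,1]$,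 $D_{\{\alpha_i\}_{i=1}^m}\in\mathcal{B}(\mathbb{C}^m)$ is the $m\times m$ diagonal matrix $\operatorname{diag}\{\sqrt{1-\alpha_1},\dots,\sqrt{1-\alpha_m}\}$; moreover, given $n\ge m$, $\tilde{D}_{\{\alpha_i\}_{i=1}^m}:\mathbb{C}^m\to\mathbb{C}^n$ is $\begin{bmatrix} D_{\{\alpha_i\}_{i=1}^m}\\ 0_{\mathbb{C}^{n-m}}\end{bmatrix}$, that is, $x\mapsto(D_{\{\alpha_i\}_{i=1}^m}x,0)\in\mathbb{C}^m\oplus\mathbb{C}^{n-m}=\mathbb{C}^n$.
   Formalization: N is required to be a normal contraction, not just a normal operator: otherwise the "if" direction fails, e.g. T = M_z ⊕ 2 on H²(D) ⊕ C has the form X_1 with n = 1 but is not a contraction, hence not 1-finite. *)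

theory Defs
  imports
    "HOL-Complex_Analysis.Complex_Analysis"
    "HOL-Combinatorics.Permutations"
    "Jordan_Normal_Form.Matrix"
begin

section \<open>Complex Hilbert spaces and operators\<close>

text \<open>The complex inner product is linear in the first argument.  Positive definiteness and
  the norm are inherited from the real inner product \<open>inner x y = Re (cinner x y)\<close>.\<close>

class complex_inner = real_inner +
  fixes scaleC :: "complex \<Rightarrow> 'a \<Rightarrow> 'a" (infixr \<open>*\<^sub>C\<close> 75)
    and cinner :: "'a \<Rightarrow> 'a \<Rightarrow> complex"
  assumes scaleC_add_right: "c *\<^sub>C (x + y) = c *\<^sub>C x + c *\<^sub>C y"
    and scaleC_add_left: "(c + d) *\<^sub>C x = c *\<^sub>C x + d *\<^sub>C x"
    and scaleC_scaleC: "c *\<^sub>C (d *\<^sub>C x) = (c * d) *\<^sub>C x"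
    and scaleR_scaleC: "r *\<^sub>R x = complex_of_real r *\<^sub>C x"
    and cinner_commute: "cinner x y = cnj (cinner y x)"
    and cinner_add_left: "cinner (x + y) z = cinner x z + cinner y z"
    and cinner_scaleC_left: "cinner (c *\<^sub>C x) y = c * cinner x y"
    and inner_eq_Re_cinner: "inner x y = Re (cinner x y)"

class chilbert_space = complex_inner + complete_space

global_interpretation complex_vector:
  vector_space "scaleC :: complex \<Rightarrow> 'a \<Rightarrow> 'a::complex_inner"
proof
  show "1 *\<^sub>C x = x" for x :: 'a
    using scaleR_scaleC[of 1 x] by simp
qed (simp_all add: scaleC_add_right scaleC_add_left scaleC_scaleC)

definition bounded_clinear :: "('a::complex_inner \<Rightarrow> 'a) \<Rightarrow> bool" where
  "bounded_clinear A \<longleftrightarrow> bounded_linear A \<and> (\<forall>c x. A (c *\<^sub>C x) = c *\<^sub>C A x)"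

definition adj :: "('a::complex_inner \<Rightarrow> 'a) \<Rightarrow> 'a \<Rightarrow> 'a" where
  "adj A = (THE B. bounded_clinear B \<and> (\<forall>x y. cinner (A x) y = cinner x (B y)))"

definition positive_op :: "('a::complex_inner \<Rightarrow> 'a) \<Rightarrow> bool" where
  "positive_op A \<longleftrightarrow> (\<forall>h. cinner (A h) h \<in> \<real> \<and> 0 \<le> Re (cinner (A h) h))"

definition sqrt_op :: "('a::complex_inner \<Rightarrow> 'a) \<Rightarrow> 'a \<Rightarrow> 'a" where
  "sqrt_op A = (THE S. bounded_clinear S \<and> positive_op S \<and> S \<circ> S = A)"

definition has_rank :: "('a::complex_inner \<Rightarrow> 'a) \<Rightarrow> nat \<Rightarrow> bool" where
  "has_rank A n \<longleftrightarrow>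
     (\<exists>B. finite B \<and> card B = n \<and> complex_vector.independent B \<and> complex_vector.span B = range A)"

definition rank_one :: "'a::complex_inner \<Rightarrow> 'a \<Rightarrow> 'a \<Rightarrow> 'a" where
  "rank_one u v h = cinner h v *\<^sub>C u"

definition ortho_proj :: "'a::complex_inner set \<Rightarrow> 'a \<Rightarrow> 'a" where
  "ortho_proj M x = (THE p. p \<in> M \<and> (\<forall>y\<in>M. cinner (x - p) y = 0))"

definition ominus :: "'a::complex_inner set \<Rightarrow> 'a set \<Rightarrow> 'a set" (infixl \<open>\<ominus>\<^sub>H\<close> 65) where
  "M \<ominus>\<^sub>H L = {x \<in> M. \<forall>y\<in>L. cinner x y = 0}"

definition orthonormal_family :: "nat \<Rightarrow> (nat \<Rightarrow> 'a::complex_inner) \<Rightarrow> bool" where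
  "orthonormal_family n e \<longleftrightarrow> (\<forall>i<n. \<forall>j<n. cinner (e i) (e j) = (if i = j then 1 else 0))"

section \<open>n-finite operators\<close>

definition self_comm :: "('a::complex_inner \<Rightarrow> 'a) \<Rightarrow> 'a \<Rightarrow> 'a" where
  "self_comm T = (\<lambda>h. adj T (T h) - T (adj T h))"

definition hyponormal :: "('a::complex_inner \<Rightarrow> 'a) \<Rightarrow> bool" where
  "hyponormal T \<longleftrightarrow> bounded_clinear T \<and> positive_op (self_comm T)"

definition contraction :: "('a::complex_inner \<Rightarrow> 'a) \<Rightarrow> bool" where
  "contraction T \<longleftrightarrow> bounded_clinear T \<and> (\<forall>h. norm (T h) \<le> norm h)"

definition defect_space :: "('a::complex_inner \<Rightarrow> 'a) \<Rightarrow> 'a set" where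
  "defect_space T = closure (range (sqrt_op (\<lambda>h. h - adj T (T h))))"

definition defect_space_adj :: "('a::complex_inner \<Rightarrow> 'a) \<Rightarrow> 'a set" where
  "defect_space_adj T = closure (range (sqrt_op (\<lambda>h. h - T (adj T h))))"

definition n_finite :: "nat \<Rightarrow> ('a::complex_inner \<Rightarrow> 'a) \<Rightarrow> bool" where
  "n_finite n T \<longleftrightarrow> hyponormal T \<and> contraction T \<and> has_rank (self_comm T) n \<and>
     range (self_comm T) \<subseteq> defect_space_adj T \<ominus>\<^sub>H defect_space T"

definition self_comm_decomp ::
  "nat \<Rightarrow> ('a::complex_inner \<Rightarrow> 'a) \<Rightarrow> (nat \<Rightarrow> 'a) \<Rightarrow> (nat \<Rightarrow> real) \<Rightarrow> bool" where
  "self_comm_decomp n T e \<alpha> \<longleftrightarrow>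
     orthonormal_family n e \<and> e ` {..<n} \<subseteq> defect_space_adj T \<ominus>\<^sub>H defect_space T \<and>
     \<alpha> ` {..<n} \<subseteq> {0<..1} \<and>
     self_comm T = (\<lambda>h. \<Sum>j<n. complex_of_real (\<alpha> j) *\<^sub>C rank_one (e j) (e j) h)"

section \<open>Operators on closed subspaces\<close>

definition bounded_clinear_on :: "'a::complex_inner set \<Rightarrow> ('a \<Rightarrow> 'a) \<Rightarrow> bool" where
  "bounded_clinear_on M A \<longleftrightarrow>
     A ` M \<subseteq> M \<and> (\<forall>x\<in>M. \<forall>y\<in>M. A (x + y) = A x + A y) \<and>
     (\<forall>c. \<forall>x\<in>M. A (c *\<^sub>C x) = c *\<^sub>C A x) \<and> (\<exists>K. \<forall>x\<in>M. norm (A x) \<le> K * norm x)"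

definition normal_on :: "'a::complex_inner set \<Rightarrow> ('a \<Rightarrow> 'a) \<Rightarrow> bool" where
  "normal_on M N \<longleftrightarrow> bounded_clinear_on M N \<and>
     (\<exists>S. bounded_clinear_on M S \<and> (\<forall>x\<in>M. \<forall>y\<in>M. cinner (N x) y = cinner x (S y)) \<and>
          (\<forall>x\<in>M. S (N x) = N (S x)))"

text \<open>Contractivity of the normal summand is necessary: a direct sum containing a normal
  operator of norm greater than 1 is not a contraction, hence not n-finite.\<close>

definition normal_contraction_on :: "'a::complex_inner set \<Rightarrow> ('a \<Rightarrow> 'a) \<Rightarrow> bool" where
  "normal_contraction_on M N \<longleftrightarrow> normal_on M N \<and> (\<forall>x\<in>M. norm (N x) \<le> norm x)"

definition closed_csubspace :: "'a::complex_inner set \<Rightarrow> bool" where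
  "closed_csubspace M \<longleftrightarrow> complex_vector.subspace M \<and> closed M"

section \<open>The Hardy space of the disc\<close>

definition taylor_coeff :: "(complex \<Rightarrow> complex) \<Rightarrow> nat \<Rightarrow> complex" where
  "taylor_coeff f k = (deriv ^^ k) f 0 / fact k"

text \<open>An analytic function on the disc is represented by its extension by 0 to the plane.\<close>

typedef hardy =
  "{f :: complex \<Rightarrow> complex. f holomorphic_on ball 0 1 \<and> (\<forall>z. z \<notin> ball 0 1 \<longrightarrow> f z = 0) \<and>
     summable (\<lambda>k. (cmod (taylor_coeff f k))\<^sup>2)}"
  morphisms hardy_fun Abs_hardy
proof
  show "(\<lambda>_. 0) \<in> {f :: complex \<Rightarrow> complex. f holomorphic_on ball 0 1 \<and>
     (\<forall>z. z \<notin> ball 0 1 \<longrightarrow> f z = 0) \<and> summable (\<lambda>k. (cmod (taylor_coeff f k))\<^sup>2)}"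
    by (simp add: taylor_coeff_def)
qed

abbreviation hcoeff :: "hardy \<Rightarrow> nat \<Rightarrow> complex" where
  "hcoeff f \<equiv> taylor_coeff (hardy_fun f)"

lemma hardy_holomorphic: "hardy_fun f holomorphic_on ball 0 1"
  using hardy_fun[of f] by simp

lemma hardy_outside: "z \<notin> ball 0 1 \<Longrightarrow> hardy_fun f z = 0"
  using hardy_fun[of f] by simp

lemma hardy_summable: "summable (\<lambda>k. (cmod (hcoeff f k))\<^sup>2)"
  using hardy_fun[of f] by simp

lemma taylor_coeff_add:
  assumes "f holomorphic_on ball 0 1" "g holomorphic_on ball 0 1"
  shows "taylor_coeff (\<lambda>z. f z + g z) k = taylor_coeff f k + taylor_coeff g k"
  using higher_deriv_add[OF assms, of 0 k] by (simp add: taylor_coeff_def add_divide_distrib)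

lemma taylor_coeff_cmult:
  assumes "f holomorphic_on ball 0 1"
  shows "taylor_coeff (\<lambda>z. c * f z) k = c * taylor_coeff f k"
  using higher_deriv_cmult[OF assms, of 0 k c] by (simp add: taylor_coeff_def)

lemma taylor_coeff_zero: "taylor_coeff (\<lambda>_. 0) k = 0"
  by (simp add: taylor_coeff_def)

lemma hcoeff_eqI:
  assumes "\<And>k. hcoeff f k = hcoeff g k"
  shows "f = g"
proof -
  have "hardy_fun f z = hardy_fun g z" for z
  proof (cases "z \<in> ball 0 1")
    case True
    have "(\<lambda>k. hcoeff f k * z ^ k) sums hardy_fun f z"
      using holomorphic_power_series[OF hardy_holomorphic True, of f] by (simp add: taylor_coeff_def)
    moreover have "(\<lambda>k. hcoeff g k * z ^ k) sums hardy_fun g z"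
      using holomorphic_power_series[OF hardy_holomorphic True, of g] by (simp add: taylor_coeff_def)
    ultimately show ?thesis
      using assms sums_unique2 by fastforce
  qed (simp add: hardy_outside)
  then show ?thesis
    by (metis ext hardy_fun_inject)
qed

lemma square_summable_add:
  fixes a b :: "nat \<Rightarrow> complex"
  assumes "summable (\<lambda>k. (cmod (a k))\<^sup>2)" "summable (\<lambda>k. (cmod (b k))\<^sup>2)"
  shows "summable (\<lambda>k. (cmod (a k + b k))\<^sup>2)"
proof (rule summable_comparison_test')
  show "summable (\<lambda>k. 2 * (cmod (a k))\<^sup>2 + 2 * (cmod (b k))\<^sup>2)"
    by (intro summable_add summable_mult assms)
  show "norm ((cmod (a k + b k))\<^sup>2) \<le> 2 * (cmod (a k))\<^sup>2 + 2 * (cmod (b k))\<^sup>2"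
    if "0 \<le> k" for k
  proof -
    have "(cmod (a k + b k))\<^sup>2 \<le> (cmod (a k) + cmod (b k))\<^sup>2"
      by (intro power_mono norm_triangle_ineq) simp
    also have "\<dots> \<le> 2 * (cmod (a k))\<^sup>2 + 2 * (cmod (b k))\<^sup>2"
      using sum_squares_bound[of "cmod (a k)" "cmod (b k)"] by (simp add: power2_sum)
    finally show ?thesis by simp
  qed
qed

lemma summable_hardy_prod: "summable (\<lambda>k. hcoeff f k * cnj (hcoeff g k))"
proof (rule summable_comparison_test')
  show "summable (\<lambda>k. (cmod (hcoeff f k))\<^sup>2 + (cmod (hcoeff g k))\<^sup>2)"
    by (intro summable_add hardy_summable)
  show "norm (hcoeff f k * cnj (hcoeff g k)) \<le> (cmod (hcoeff f k))\<^sup>2 + (cmod (hcoeff g k))\<^sup>2"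
    if "0 \<le> k" for k
    using sum_squares_bound[of "cmod (hcoeff f k)" "cmod (hcoeff g k)"]
      mult_nonneg_nonneg[of "cmod (hcoeff f k)" "cmod (hcoeff g k)"]
    by (simp add: norm_mult del: mult_nonneg_nonneg zero_le_mult_iff)
qed

instantiation hardy :: complex_inner
begin

definition "0 = Abs_hardy (\<lambda>_. 0)"
definition "f + g = Abs_hardy (\<lambda>z. hardy_fun f z + hardy_fun g z)"
definition "c *\<^sub>C f = Abs_hardy (\<lambda>z. c * hardy_fun f z)"
definition "r *\<^sub>R f = complex_of_real r *\<^sub>C (f :: hardy)"
definition "- f = (-1) *\<^sub>C (f :: hardy)"
definition "f - g = f + - (g :: hardy)"
definition "cinner f g = (\<Sum>k. hcoeff f k * cnj (hcoeff g k))"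
definition "inner f g = Re (cinner f (g :: hardy))"
definition "norm f = sqrt (inner f (f :: hardy))"
definition "dist f g = norm (f - g :: hardy)"
definition "sgn f = inverse (norm f) *\<^sub>R (f :: hardy)"
definition "uniformity = (INF e\<in>{0<..}. principal {(f, g :: hardy). dist f g < e})"
definition "open U = (\<forall>f\<in>U. \<forall>\<^sub>F (f', g) in uniformity. f' = f \<longrightarrow> g \<in> (U :: hardy set))"

lemma hardy_fun_zero: "hardy_fun 0 = (\<lambda>_. 0)"
  unfolding zero_hardy_def by (rule Abs_hardy_inverse) (simp add: taylor_coeff_zero)

lemma hardy_fun_add: "hardy_fun (f + g) = (\<lambda>z. hardy_fun f z + hardy_fun g z)"
  unfolding plus_hardy_def
  by (rule Abs_hardy_inverse)
     (auto intro!: holomorphic_on_add hardy_holomorphic square_summable_add hardy_summable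
           simp: hardy_outside taylor_coeff_add hardy_holomorphic)

lemma hardy_fun_scaleC: "hardy_fun (c *\<^sub>C f) = (\<lambda>z. c * hardy_fun f z)"
  unfolding scaleC_hardy_def
  by (rule Abs_hardy_inverse)
     (auto intro!: holomorphic_on_mult hardy_holomorphic summable_mult hardy_summable
           simp: hardy_outside taylor_coeff_cmult hardy_holomorphic norm_mult power_mult_distrib)

lemma hcoeff_zero: "hcoeff 0 k = 0"
  by (simp add: hardy_fun_zero taylor_coeff_zero)

lemma hcoeff_add: "hcoeff (f + g) k = hcoeff f k + hcoeff g k"
  by (simp add: hardy_fun_add taylor_coeff_add hardy_holomorphic)

lemma hcoeff_scaleC: "hcoeff (c *\<^sub>C f) k = c * hcoeff f k"
  by (simp add: hardy_fun_scaleC taylor_coeff_cmult hardy_holomorphic)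

lemma Re_cinner_self_hardy: "Re (cinner f f) = (\<Sum>k. (cmod (hcoeff f k))\<^sup>2)"
  unfolding cinner_hardy_def
  by (subst Re_suminf[OF summable_hardy_prod]) (simp add: complex_norm_square[symmetric] flip: of_real_power)

instance
proof
  fix f g h :: hardy and c d :: complex and r s :: real
  note [simp] = hcoeff_zero hcoeff_add hcoeff_scaleC
  show "f + g + h = f + (g + h)" "f + g = g + f" "0 + f = f"
    by (rule hcoeff_eqI; simp)+
  show "- f + f = 0"
    by (rule hcoeff_eqI) (simp add: uminus_hardy_def)
  show "f - g = f + - g"
    by (simp add: minus_hardy_def)
  show "c *\<^sub>C (f + g) = c *\<^sub>C f + c *\<^sub>C g" "(c + d) *\<^sub>C f = c *\<^sub>C f + d *\<^sub>C f"
    "c *\<^sub>C (d *\<^sub>C f) = (c * d) *\<^sub>C f"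
    by (rule hcoeff_eqI; simp add: algebra_simps)+
  show "r *\<^sub>R f = complex_of_real r *\<^sub>C f"
    by (simp add: scaleR_hardy_def)
  show "r *\<^sub>R (f + g) = r *\<^sub>R f + r *\<^sub>R g" "(r + s) *\<^sub>R f = r *\<^sub>R f + s *\<^sub>R f"
    "r *\<^sub>R (s *\<^sub>R f) = (r * s) *\<^sub>R f" "1 *\<^sub>R f = f"
    by (rule hcoeff_eqI; simp add: scaleR_hardy_def algebra_simps)+
  show "dist f g = norm (f - g)"
    by (simp add: dist_hardy_def)
  show "sgn f = inverse (norm f) *\<^sub>R f"
    by (simp add: sgn_hardy_def)
  show "uniformity = (INF e\<in>{0<..}. principal {(f, g :: hardy). dist f g < e})"
    by (simp add: uniformity_hardy_def)
  show "open U = (\<forall>f\<in>U. \<forall>\<^sub>F (f', g) in uniformity. f' = f \<longrightarrow> g \<in> U)" for U :: "hardy set"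
    by (simp add: open_hardy_def)
  show comm: "cinner f g = cnj (cinner g f)" for f g :: hardy
    unfolding cinner_hardy_def
    by (simp add: bounded_linear.suminf[OF bounded_linear_cnj summable_hardy_prod] mult.commute)
  show add: "cinner (f + g) h = cinner f h + cinner g h" for f g h :: hardy
    unfolding cinner_hardy_def
    by (simp add: distrib_right suminf_add[OF summable_hardy_prod summable_hardy_prod])
  show scale: "cinner (c *\<^sub>C f) g = c * cinner f g" for c and f g :: hardy
    unfolding cinner_hardy_def
    by (simp add: mult.assoc suminf_mult[OF summable_hardy_prod])
  show "inner f g = Re (cinner f g)"
    by (simp add: inner_hardy_def)
  show "inner f g = inner g f"
    unfolding inner_hardy_def using comm[of f g] by simp
  show "inner (f + g) h = inner f h + inner g h"
    by (simp add: inner_hardy_def add)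
  show "inner (r *\<^sub>R f) g = r * inner f g"
    by (simp add: inner_hardy_def scaleR_hardy_def scale)
  show "0 \<le> inner f f"
    unfolding inner_hardy_def Re_cinner_self_hardy
    by (intro suminf_nonneg hardy_summable) simp
  show "inner f f = 0 \<longleftrightarrow> f = 0"
  proof
    assume "inner f f = 0"
    then have "(cmod (hcoeff f k))\<^sup>2 = 0" for k
      unfolding inner_hardy_def Re_cinner_self_hardy
      using suminf_eq_zero_iff[OF hardy_summable, of f] by simp
    then show "f = 0"
      by (intro hcoeff_eqI) simp
  qed (simp add: inner_hardy_def Re_cinner_self_hardy)
  show "norm f = sqrt (inner f f)"
    by (simp add: norm_hardy_def)
qed

end

definition hardy_Mz :: "hardy \<Rightarrow> hardy" where
  "hardy_Mz f = Abs_hardy (\<lambda>z. z * hardy_fun f z)"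

definition hardy_const :: "complex \<Rightarrow> hardy" where
  "hardy_const c = Abs_hardy (\<lambda>z. if z \<in> ball 0 1 then c else 0)"

definition hardy_PC :: "hardy \<Rightarrow> hardy" where
  "hardy_PC = ortho_proj (range hardy_const)"

lemma taylor_coeff_const:
  "taylor_coeff (\<lambda>z. if z \<in> ball 0 1 then c else 0) k = (if k = 0 then c else 0)"
proof -
  have "(deriv ^^ k) (\<lambda>z. if z \<in> ball 0 1 then c else 0) 0 = (deriv ^^ k) (\<lambda>_. c) (0::complex)"
  proof (rule higher_deriv_cong_ev)
    show "\<forall>\<^sub>F z in nhds 0. (if z \<in> ball 0 1 then c else 0) = c"
      by (rule eventually_mono[OF eventually_nhds_in_open[of "ball 0 1"]]) auto
  qed simp
  then show ?thesis
    by (simp add: taylor_coeff_def)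
qed

text \<open>The arguments of \<^const>\<open>Abs_hardy\<close> in the definitions of \<^const>\<open>hardy_Mz\<close> and
  \<^const>\<open>hardy_const\<close> do belong to the Hardy space.\<close>

lemma hardy_fun_const: "hardy_fun (hardy_const c) = (\<lambda>z. if z \<in> ball 0 1 then c else 0)"
  unfolding hardy_const_def
proof (rule Abs_hardy_inverse, intro CollectI conjI)
  show "(\<lambda>z. if z \<in> ball 0 1 then c else 0) holomorphic_on ball 0 1"
    by (rule holomorphic_transform[of "\<lambda>_. c"]) auto
  show "summable (\<lambda>k. (cmod (taylor_coeff (\<lambda>z. if z \<in> ball 0 1 then c else 0) k))\<^sup>2)"
    unfolding taylor_coeff_const by (rule summable_finite[of "{0}"]) auto
qed auto

lemma taylor_coeff_mult_z:
  assumes "f holomorphic_on ball 0 1"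
  shows "taylor_coeff (\<lambda>z. z * f z) k = (case k of 0 \<Rightarrow> 0 | Suc j \<Rightarrow> taylor_coeff f j)"
proof (cases k)
  case (Suc j)
  have "(deriv ^^ k) (\<lambda>z. z * f z) 0 =
      (\<Sum>i = 0..k. of_nat (k choose i) * (deriv ^^ i) (\<lambda>z. z) 0 * (deriv ^^ (k - i)) f 0)"
    by (rule higher_deriv_mult[OF _ assms]) auto
  also have "\<dots> = (\<Sum>i\<in>{1}. of_nat (k choose i) * (deriv ^^ i) (\<lambda>z. z) 0 * (deriv ^^ (k - i)) f 0)"
    using Suc by (intro sum.mono_neutral_right) auto
  also have "\<dots> = of_nat (Suc j) * (deriv ^^ j) f 0"
    using Suc by simp
  finally show ?thesis
    using Suc by (simp add: taylor_coeff_def del: of_nat_Suc)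
qed (simp add: taylor_coeff_def)

lemma hardy_fun_Mz: "hardy_fun (hardy_Mz f) = (\<lambda>z. z * hardy_fun f z)"
  unfolding hardy_Mz_def
proof (rule Abs_hardy_inverse, intro CollectI conjI)
  show "(\<lambda>z. z * hardy_fun f z) holomorphic_on ball 0 1"
    by (intro holomorphic_intros hardy_holomorphic)
  have "summable (\<lambda>k. (cmod (taylor_coeff (\<lambda>z. z * hardy_fun f z) (Suc k)))\<^sup>2)"
    using hardy_summable[of f] by (simp add: taylor_coeff_mult_z hardy_holomorphic)
  then show "summable (\<lambda>k. (cmod (taylor_coeff (\<lambda>z. z * hardy_fun f z) k))\<^sup>2)"
    by (subst (asm) summable_Suc_iff)
qed (simp add: hardy_outside)

section \<open>Direct sums, amplifications and unitary equivalence\<close>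

text \<open>The numbers of copies of the Hardy space in the model spaces vary inside the statement,
  so these spaces are given by a carrier together with its vector space operations and inner
  product.\<close>

record 'v ip_space =
  car :: "'v set"
  vadd :: "'v \<Rightarrow> 'v \<Rightarrow> 'v"
  vscale :: "complex \<Rightarrow> 'v \<Rightarrow> 'v"
  vinner :: "'v \<Rightarrow> 'v \<Rightarrow> complex"

definition subspace_ip :: "'a::complex_inner set \<Rightarrow> 'a ip_space" where
  "subspace_ip M = \<lparr>car = M, vadd = (+), vscale = (*\<^sub>C), vinner = cinner\<rparr>"

text \<open>The Hilbert space tensor product of \<open>'h\<close> with \<open>\<complex>\<close>\<open>\<^sup>n\<close>: the vector with
  components \<open>F\<^sub>i\<close> is the sum of the elementary tensors of \<open>F\<^sub>i\<close> with the \<open>i\<close>-th standard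
  basis vector.\<close>

definition tensor_Cn :: "nat \<Rightarrow> 'h::complex_inner Matrix.vec ip_space" where
  "tensor_Cn n = \<lparr>car = carrier_vec n, vadd = (+), vscale = (\<lambda>c. map_vec ((*\<^sub>C) c)),
     vinner = (\<lambda>F G. \<Sum>i<n. cinner (vec_index F i) (vec_index G i))\<rparr>"

text \<open>The operator \<open>A \<otimes> B\<close> for an operator \<open>A\<close> on \<open>'h\<close> and a matrix \<open>B\<close>.\<close>

definition tensor_op ::
  "('h::complex_inner \<Rightarrow> 'h) \<Rightarrow> complex mat \<Rightarrow> 'h Matrix.vec \<Rightarrow> 'h Matrix.vec" where
  "tensor_op A B F =
     Matrix.vec (dim_row B) (\<lambda>i. \<Sum>j<dim_col B. (B $$ (i, j)) *\<^sub>C A (vec_index F j))"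

definition dsum :: "'v ip_space \<Rightarrow> 'w ip_space \<Rightarrow> ('v \<times> 'w) ip_space" where
  "dsum V W = \<lparr>car = car V \<times> car W,
     vadd = (\<lambda>(v, w) (v', w'). (vadd V v v', vadd W w w')),
     vscale = (\<lambda>c (v, w). (vscale V c v, vscale W c w)),
     vinner = (\<lambda>(v, w) (v', w'). vinner V v v' + vinner W w w')\<rparr>"

definition unitary_between :: "('v \<Rightarrow> 'w) \<Rightarrow> 'v ip_space \<Rightarrow> 'w ip_space \<Rightarrow> bool" where
  "unitary_between U V W \<longleftrightarrow> bij_betw U (car V) (car W) \<and>
     (\<forall>x\<in>car V. \<forall>y\<in>car V. U (vadd V x y) = vadd W (U x) (U y)) \<and>
     (\<forall>c. \<forall>x\<in>car V. U (vscale V c x) = vscale W c (U x)) \<and>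
     (\<forall>x\<in>car V. \<forall>y\<in>car V. vinner W (U x) (U y) = vinner V x y)"

definition unitarily_equivalent ::
  "'v ip_space \<Rightarrow> ('v \<Rightarrow> 'v) \<Rightarrow> 'w ip_space \<Rightarrow> ('w \<Rightarrow> 'w) \<Rightarrow> bool" where
  "unitarily_equivalent V S W X \<longleftrightarrow>
     (\<exists>U. unitary_between U V W \<and> (\<forall>x\<in>car V. U (S x) = X (U x)))"

section \<open>The model operators\<close>

definition D_mat :: "nat \<Rightarrow> (nat \<Rightarrow> real) \<Rightarrow> complex mat" where
  "D_mat m \<alpha> = mat_diag m (\<lambda>i. complex_of_real (sqrt (1 - \<alpha> i)))"

definition D_tilde_mat :: "nat \<Rightarrow> nat \<Rightarrow> (nat \<Rightarrow> real) \<Rightarrow> complex mat" where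
  "D_tilde_mat n m \<alpha> = D_mat m \<alpha> @\<^sub>r 0\<^sub>m (n - m) m"

definition X1_space :: "nat \<Rightarrow> 'a::complex_inner set \<Rightarrow> (hardy Matrix.vec \<times> 'a) ip_space" where
  "X1_space n H0 = dsum (tensor_Cn n) (subspace_ip H0)"

definition X1 :: "nat \<Rightarrow> ('a \<Rightarrow> 'a) \<Rightarrow> hardy Matrix.vec \<times> 'a \<Rightarrow> hardy Matrix.vec \<times> 'a" where
  "X1 n N = (\<lambda>(F, h). (tensor_op hardy_Mz (1\<^sub>m n) F, N h))"

definition X2_space ::
  "nat \<Rightarrow> nat \<Rightarrow> 'a::complex_inner set \<Rightarrow> (hardy Matrix.vec \<times> hardy Matrix.vec \<times> 'a) ip_space" where
  "X2_space n m H0 = dsum (tensor_Cn n) (dsum (tensor_Cn m) (subspace_ip H0))"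

definition X2 ::
  "nat \<Rightarrow> nat \<Rightarrow> (nat \<Rightarrow> real) \<Rightarrow> ('a \<Rightarrow> 'a) \<Rightarrow>
   hardy Matrix.vec \<times> hardy Matrix.vec \<times> 'a \<Rightarrow> hardy Matrix.vec \<times> hardy Matrix.vec \<times> 'a" where
  "X2 n m \<alpha> N = (\<lambda>(F, G, h).
     (tensor_op hardy_Mz (1\<^sub>m n) F + tensor_op hardy_PC (D_tilde_mat n m \<alpha>) G,
      tensor_op (adj hardy_Mz) (D_mat m \<alpha>) G,
      N h))"

definition equiv_X1 :: "nat \<Rightarrow> ('a::complex_inner \<Rightarrow> 'a) \<Rightarrow> bool" where
  "equiv_X1 n T \<longleftrightarrow> (\<exists>(H0 :: 'a set) (N :: 'a \<Rightarrow> 'a). closed_csubspace H0 \<and> normal_contraction_on H0 N \<and>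
     unitarily_equivalent (subspace_ip UNIV) T (X1_space n H0) (X1 n N))"

definition equiv_X2 ::
  "nat \<Rightarrow> nat \<Rightarrow> (nat \<Rightarrow> real) \<Rightarrow> ('a::complex_inner \<Rightarrow> 'a) \<Rightarrow> bool" where
  "equiv_X2 n m \<alpha> T \<longleftrightarrow> (\<exists>(H0 :: 'a set) (N :: 'a \<Rightarrow> 'a). closed_csubspace H0 \<and> normal_contraction_on H0 N \<and>
     unitarily_equivalent (subspace_ip UNIV) T (X2_space n m H0) (X2 n m \<alpha> N))"

end

(* Since ran [T*,T] is orthogonal to D_T, each e_j satisfies
   T*T e_j = e_j; hyponormality propagates this along the orbit, so p_k = T^k e_j is an orthonormal
   forward shift chain.  [T*,T] vanishes on the orthogonal complement of all e_j, hence for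
   c = sqrt (1 - alpha_j) > 0 the vectors q_k = c^-(k+1) T*^(k+1) e_j form an orthonormal chain with
   T q_(k+1) = c q_k and T q_0 = c p_0.  The chains span a reducing subspace on which T is the Hardy
   space part of X_2, with m the number of alpha_j < 1, and T is normal on its complement.
   Conversely, [X_2*, X_2] is alpha_j P_C in the j-th coordinate of the first summand (alpha_j = 1 for
   j >= m) and 0 elsewhere, so that e_j is the constant 1 there; X_1 is the case m = 0 of X_2. *)
theory Submission
  imports Defs
begin

section \<open>Complex inner products\<close>

text \<open>n-finiteness is phrased with square roots, the model with T and its adjoint alone. The
  bridge is that x is orthogonal to D_T exactly when T*T x = x, as S S x = 0 forces S x = 0 for a
  selfadjoint S; each e_j then lies in D_{T*} at once, since e_j - T T* e_j = alpha_j e_j. As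
  \<open>sqrt_op\<close> is a definite description, existence and uniqueness of the positive root
  come first. The orbit step rests on equality in a chain of norms: if T*T h = h, then |Th| = |h| =
  |T*T h| <= |T T h| <= |Th|, and a contraction that preserves the norm of y satisfies T*T y = y.
  Both T*T and TT* then fix T h, so the self-commutator kills it, and alpha_l > 0 makes T h
  orthogonal to every e_l. The powers of c arise from T T*^(k+1) e_j = c^2 T*^k e_j: one factor c
  per step shares this square equally between T and T*, which makes the backward chain orthonormal.
  If alpha_j = 1, then T* e_j = 0 and no backward chain starts. Since X_2 couples the first m
  coordinates, the e_j have to be reordered.\<close>

lemma cinner_add_right: "cinner x (y + z) = cinner x y + cinner x z"
  by (subst (1 2 3) cinner_commute) (simp add: cinner_add_left)

lemma cinner_scaleC_right: "cinner x (c *\<^sub>C y) = cnj c * cinner x y"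
  by (subst (1 2) cinner_commute) (simp add: cinner_scaleC_left)

lemma cinner_zero_left [simp]: "cinner 0 x = 0"
  using cinner_add_left[of 0 0 x] by simp

lemma cinner_zero_right [simp]: "cinner x 0 = 0"
  using cinner_add_right[of x 0 0] by simp

lemma cinner_minus_left: "cinner (- x) y = - cinner x y"
  using cinner_add_left[of x "- x" y] by (simp add: eq_neg_iff_add_eq_0 add.commute)

lemma cinner_minus_right: "cinner x (- y) = - cinner x y"
  using cinner_add_right[of x y "- y"] by (simp add: eq_neg_iff_add_eq_0 add.commute)

lemma cinner_diff_left: "cinner (x - y) z = cinner x z - cinner y z"
  using cinner_add_left[of x "- y" z] by (simp add: cinner_minus_left)

lemma cinner_diff_right: "cinner x (y - z) = cinner x y - cinner x z"
  using cinner_add_right[of x y "- z"] by (simp add: cinner_minus_right)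

lemma cinner_sum_left: "cinner (\<Sum>i\<in>A. f i) y = (\<Sum>i\<in>A. cinner (f i) y)"
  by (induction A rule: infinite_finite_induct) (simp_all add: cinner_add_left)

lemma cinner_sum_right: "cinner y (\<Sum>i\<in>A. f i) = (\<Sum>i\<in>A. cinner y (f i))"
  by (induction A rule: infinite_finite_induct) (simp_all add: cinner_add_right)

lemmas cinner_simps = cinner_add_left cinner_add_right cinner_scaleC_left cinner_scaleC_right
  cinner_diff_left cinner_diff_right cinner_minus_left cinner_minus_right

lemma cinner_self: "cinner x x = complex_of_real ((norm x)\<^sup>2)"
proof (rule complex_eqI)
  show "Re (cinner x x) = Re (complex_of_real ((norm x)\<^sup>2))"
    by (simp add: power2_norm_eq_inner inner_eq_Re_cinner)
  have "Im (cinner x x) = - Im (cinner x x)"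
    using arg_cong[OF cinner_commute[of x x], of Im] by simp
  then show "Im (cinner x x) = Im (complex_of_real ((norm x)\<^sup>2))"
    by simp
qed

lemma cinner_self_eq_0_iff: "cinner x x = 0 \<longleftrightarrow> x = 0"
  by (simp add: cinner_self)

lemma cinner_eqI:
  assumes "\<And>y. cinner x y = cinner x' y"
  shows "x = x'"
  using assms[of "x - x'"] cinner_self_eq_0_iff[of "x - x'"] by (simp add: cinner_diff_left)

lemma norm_scaleC: "norm (c *\<^sub>C x) = cmod c * norm x"
proof -
  have "cinner (c *\<^sub>C x) (c *\<^sub>C x) = complex_of_real ((cmod c * norm x)\<^sup>2)"
    using complex_norm_square[of c]
    by (simp add: cinner_scaleC_left cinner_scaleC_right cinner_self[of x] power_mult_distrib mult.assoc)
  then have "(norm (c *\<^sub>C x))\<^sup>2 = (cmod c * norm x)\<^sup>2"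
    unfolding cinner_self by (metis of_real_eq_iff)
  then show ?thesis
    by (simp add: power2_eq_iff_nonneg)
qed

text \<open>Multiplying x by \<open>cnj (cinner x y)\<close> makes the inner product real and
  nonnegative, so the real Cauchy-Schwarz inequality applies.\<close>

lemma cmod_cinner_le: "cmod (cinner x y) \<le> norm x * norm y"
proof (cases "cinner x y = 0")
  case False
  let ?c = "cinner x y"
  have "(cmod ?c)\<^sup>2 = Re (cnj ?c * ?c)"
    using complex_norm_square[of ?c] by (metis Re_complex_of_real mult.commute)
  also have "\<dots> = inner (cnj ?c *\<^sub>C x) y"
    by (simp add: inner_eq_Re_cinner cinner_scaleC_left)
  also have "\<dots> \<le> norm (cnj ?c *\<^sub>C x) * norm y"
    by (rule norm_cauchy_schwarz)
  finally have "cmod ?c * cmod ?c \<le> cmod ?c * (norm x * norm y)"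
    by (simp add: norm_scaleC power2_eq_square mult.assoc)
  with False show ?thesis
    by (simp add: mult_le_cancel_left)
qed simp

lemma bounded_linear_cinner_left: "bounded_linear (\<lambda>x. cinner x y)"
  by (rule bounded_linear_intro[where K = "norm y"])
     (simp_all add: cinner_add_left scaleR_scaleC cinner_scaleC_left scaleR_conv_of_real cmod_cinner_le)

lemma bounded_linear_cinner_right: "bounded_linear (\<lambda>y. cinner x y)"
  by (rule bounded_linear_intro[where K = "norm x"])
     (simp_all add: cinner_add_right scaleR_scaleC cinner_scaleC_right scaleR_conv_of_real
       cmod_cinner_le mult.commute[of "norm x"] order_trans[OF cmod_cinner_le])

lemma bounded_linear_scaleC: "bounded_linear (\<lambda>x :: 'a::complex_inner. c *\<^sub>C x)"
  by (rule bounded_linear_intro[where K = "cmod c"])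
     (simp_all add: scaleC_add_right scaleR_scaleC scaleC_scaleC norm_scaleC mult.commute)

text \<open>The imaginary part of \<open>cinner x y\<close> is the real part for -i x in place of x.
  Adjoint identities therefore need to be proved for the real inner product only.\<close>

lemma cinner_conv_inner: "cinner x y = Complex (inner x y) (inner (- (\<i> *\<^sub>C x)) y)"
  by (rule complex_eqI) (simp_all add: inner_eq_Re_cinner cinner_simps)

lemma bounded_clinear_scaleC: "bounded_clinear A \<Longrightarrow> A (c *\<^sub>C x) = c *\<^sub>C A x"
  by (simp add: bounded_clinear_def)

lemma bounded_clinear_bounded_linear: "bounded_clinear A \<Longrightarrow> bounded_linear A"
  by (simp add: bounded_clinear_def)

lemma cinner_adjoint_of_inner_adjoint:
  assumes A: "bounded_clinear A" and AB: "\<And>x y. inner (A x) y = inner x (B y)"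
  shows "cinner (A x) y = cinner x (B y)"
proof -
  interpret bounded_linear A by (rule bounded_clinear_bounded_linear[OF A])
  have "A (- (\<i> *\<^sub>C x)) = - (\<i> *\<^sub>C A x)"
    by (simp add: neg bounded_clinear_scaleC[OF A])
  then show ?thesis
    unfolding cinner_conv_inner using AB[of "- (\<i> *\<^sub>C x)" y] AB[of x y] by simp
qed

section \<open>The adjoint\<close>

text \<open>A first-order condition: near t = 0 the linear term dominates, so it must vanish. It
  serves both the minimiser in the Riesz theorem and the null vectors of a positive
  operator.\<close>

lemma nonneg_quadratic_imp_zero:
  fixes b w :: real
  assumes "\<And>t. 0 \<le> 2 * t * b + t\<^sup>2 * w" "0 \<le> w"
  shows "b = 0"
proof (rule ccontr)
  assume b: "b \<noteq> 0"
  \<comment> \<open>At t = - b s the quadratic equals b^2 s (s w - 2), which is negative because s w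
    <= 1.\<close>
  define s where "s = inverse (1 + w)"
  have s: "0 < s" "s * w \<le> 1"
    using assms(2) by (simp_all add: s_def field_simps)
  have "0 \<le> 2 * (- b * s) * b + (- b * s)\<^sup>2 * w"
    by (rule assms(1))
  also have "\<dots> = (b\<^sup>2 * s) * (s * w - 2)"
    by (simp add: power2_eq_square algebra_simps)
  finally have "0 \<le> (b\<^sup>2 * s) * (s * w - 2)" .
  moreover have "0 < b\<^sup>2 * s"
    using b s(1) by simp
  ultimately have "0 \<le> s * w - 2"
    by (meson mult_pos_neg not_le)
  with s(2) show False
    by simp
qed

text \<open>The representing vector minimises \<open>norm y ^ 2 - 2 * g y\<close>; by the parallelogram law a
  minimising sequence is Cauchy.\<close>

lemma riesz_representation_real:
  fixes g :: "'a::{real_inner,complete_space} \<Rightarrow> real"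
  assumes g: "bounded_linear g"
  shows "\<exists>y. \<forall>x. g x = inner x y"
proof -
  interpret g: bounded_linear g by (rule g)
  define \<phi> where "\<phi> = (\<lambda>y. (norm y)\<^sup>2 - 2 * g y)"
  obtain K where K: "\<And>x. norm (g x) \<le> norm x * K"
    using g.bounded by blast
  have lower: "- K\<^sup>2 \<le> \<phi> y" for y
  proof -
    have "2 * g y \<le> 2 * (norm y * K)"
      using K[of y] by simp
    also have "\<dots> \<le> (norm y)\<^sup>2 + K\<^sup>2"
      using sum_squares_bound[of "norm y" K] by simp
    finally show ?thesis
      by (simp add: \<phi>_def)
  qed
  define d where "d = Inf (range \<phi>)"
  have bdd: "bdd_below (range \<phi>)"
    using lower by (auto intro!: bdd_belowI2)
  have d_le: "d \<le> \<phi> y" for y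
    unfolding d_def using bdd by (auto intro: cInf_lower)
  have "\<exists>y. \<phi> y < d + inverse (real (Suc n))" for n
    using cInf_lessD[of "range \<phi>" "d + inverse (real (Suc n))"] by (auto simp: d_def)
  then obtain Y where Y: "\<And>n. \<phi> (Y n) < d + inverse (real (Suc n))"
    by metis
  \<comment> \<open>The midpoint of x and y has a value of at least d, and the linear terms in g
    cancel in the parallelogram law.\<close>
  have par: "(norm (x - y))\<^sup>2 \<le> 2 * (\<phi> x - d) + 2 * (\<phi> y - d)" for x y
  proof -
    have "4 * \<phi> ((1 / 2) *\<^sub>R (x + y)) = (norm (x + y))\<^sup>2 - 4 * (g x + g y)"
      by (simp add: \<phi>_def g.scaleR g.add power_divide power_mult_distrib right_diff_distrib)
        (simp add: field_simps)
    moreover have "(norm (x + y))\<^sup>2 + (norm (x - y))\<^sup>2 = 2 * (norm x)\<^sup>2 + 2 * (norm y)\<^sup>2"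
      by (simp add: power2_norm_eq_inner inner_simps inner_commute)
    ultimately show ?thesis
      using d_le[of "(1 / 2) *\<^sub>R (x + y)"] by (simp add: \<phi>_def algebra_simps)
  qed
  have "Cauchy Y"
  proof (rule metric_CauchyI)
    fix e :: real
    assume e: "0 < e"
    then obtain N where N: "inverse (real (Suc N)) < e\<^sup>2 / 4"
      using reals_Archimedean[of "e\<^sup>2 / 4"] by auto
    have small: "\<phi> (Y n) - d < e\<^sup>2 / 4" if "N \<le> n" for n
    proof -
      have "\<phi> (Y n) - d < inverse (real (Suc n))"
        using Y[of n] by (simp add: less_diff_eq diff_less_eq add.commute)
      also have "\<dots> \<le> inverse (real (Suc N))"
        using that by (simp add: le_imp_inverse_le)
      also note N
      finally show ?thesis .
    qed
    show "\<exists>M. \<forall>m\<ge>M. \<forall>n\<ge>M. dist (Y m) (Y n) < e"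
    proof (intro exI allI impI)
      fix m n
      assume "N \<le> m" "N \<le> n"
      then have "2 * (\<phi> (Y m) - d) + 2 * (\<phi> (Y n) - d) < 2 * (e\<^sup>2 / 4) + 2 * (e\<^sup>2 / 4)"
        by (intro add_strict_mono mult_strict_left_mono small) simp_all
      then have "(norm (Y m - Y n))\<^sup>2 < e\<^sup>2"
        using par[of "Y m" "Y n"] by simp
      then show "dist (Y m) (Y n) < e"
        unfolding dist_norm by (rule power2_less_imp_less) (use e in simp)
    qed
  qed
  then obtain y where y: "Y \<longlonglongrightarrow> y"
    using Cauchy_convergent_iff convergent_def by blast
  have "(\<lambda>n. \<phi> (Y n)) \<longlonglongrightarrow> \<phi> y"
    unfolding \<phi>_def
    by (intro tendsto_diff tendsto_power tendsto_norm tendsto_mult tendsto_const g.tendsto y)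
  moreover have "(\<lambda>n. d + inverse (real (Suc n))) \<longlonglongrightarrow> d + 0"
    by (intro tendsto_add tendsto_const LIMSEQ_inverse_real_of_nat)
  ultimately have "\<phi> y \<le> d + 0"
    by (rule LIMSEQ_le) (use Y in \<open>auto intro: less_imp_le\<close>)
  then have min: "\<phi> y \<le> \<phi> (y + t *\<^sub>R x)" for t x
    using d_le[of "y + t *\<^sub>R x"] by simp
  have "g x = inner x y" for x
  proof -
    define b where "b = inner x y - g x"
    have "0 \<le> 2 * t * b + t\<^sup>2 * (norm x)\<^sup>2" for t
    proof -
      have "(norm (y + t *\<^sub>R x))\<^sup>2 = (norm y)\<^sup>2 + 2 * (t * inner x y) + t\<^sup>2 * (norm x)\<^sup>2"
        unfolding power2_norm_eq_inner
        by (simp add: inner_simps inner_commute) (simp add: power2_eq_square)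
      then show ?thesis
        using min[of t x] by (simp add: \<phi>_def b_def g.add g.scaleR algebra_simps)
    qed
    then have "b = 0"
      by (rule nonneg_quadratic_imp_zero) simp
    then show ?thesis
      by (simp add: b_def)
  qed
  then show ?thesis
    by blast
qed

text \<open>The Riesz theorem represents x |-> \<open>inner (A x) y\<close> by a vector B y.
  Additivity and complex homogeneity of B follow because a vector is determined by its inner
  products.\<close>

lemma adjoint_exists:
  fixes A :: "'a::chilbert_space \<Rightarrow> 'a"
  assumes A: "bounded_clinear A"
  shows "\<exists>B. bounded_clinear B \<and> (\<forall>x y. cinner (A x) y = cinner x (B y))"
proof -
  interpret A: bounded_linear A by (rule bounded_clinear_bounded_linear[OF A])
  have "\<exists>z. \<forall>x. inner (A x) y = inner x z" for y
    by (rule riesz_representation_real)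
       (rule bounded_linear_compose[OF bounded_linear_inner_left A.bounded_linear_axioms])
  then obtain B where B: "\<And>x y. inner (A x) y = inner x (B y)"
    by metis
  note cB = cinner_adjoint_of_inner_adjoint[OF A B]
  have cB': "cinner (B y) x = cinner y (A x)" for x y
    using cB[of x y] cinner_commute[of "B y" x] cinner_commute[of y "A x"] by simp
  obtain K where K: "\<And>x. norm (A x) \<le> norm x * K"
    using A.bounded by blast
  have "bounded_linear B"
  proof (rule bounded_linear_intro[where K = K])
    show "B (x + y) = B x + B y" for x y
      by (rule cinner_eqI) (simp add: cB' cinner_add_left)
    show "B (r *\<^sub>R x) = r *\<^sub>R B x" for r x
      by (rule cinner_eqI) (simp add: cB' cinner_scaleC_left scaleR_scaleC)
    show "norm (B x) \<le> norm x * K" for x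
    proof (cases "B x = 0")
      case True
      then show ?thesis
        using order_trans[OF norm_ge_zero K[of x]] by simp
    next
      case False
      \<comment> \<open>A bound for A yields the same bound for B after division by the norm of B
        x.\<close>
      have "norm (B x) * norm (B x) = inner (A (B x)) x"
        by (simp add: B power2_norm_eq_inner flip: power2_eq_square)
      also have "\<dots> \<le> norm (A (B x)) * norm x"
        by (rule norm_cauchy_schwarz)
      also have "\<dots> \<le> (norm (B x) * K) * norm x"
        by (intro mult_right_mono K) simp
      finally have "norm (B x) * norm (B x) \<le> norm (B x) * (norm x * K)"
        by (simp add: mult_ac)
      with False show ?thesis
        by (simp add: mult_le_cancel_left)
    qed
  qed
  moreover have "B (c *\<^sub>C x) = c *\<^sub>C B x" for c x
    by (rule cinner_eqI) (simp add: cB' cinner_scaleC_left)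
  ultimately show ?thesis
    using cB by (auto simp: bounded_clinear_def)
qed

lemma adj_eqI:
  assumes "bounded_clinear B" "\<And>x y. cinner (A x) y = cinner x (B y)"
  shows "adj A = B"
  unfolding adj_def
proof (rule the_equality)
  fix C
  assume C: "bounded_clinear C \<and> (\<forall>x y. cinner (A x) y = cinner x (C y))"
  have "C y = B y" for y
    by (rule cinner_eqI) (metis C assms(2) cinner_commute)
  then show "C = B" by blast
qed (use assms in blast)

lemma
  fixes A :: "'a::chilbert_space \<Rightarrow> 'a"
  assumes "bounded_clinear A"
  shows bounded_clinear_adj: "bounded_clinear (adj A)"
    and cinner_adj: "cinner (A x) y = cinner x (adj A y)"
    and cinner_adj': "cinner (adj A x) y = cinner x (A y)"
proof -
  obtain B where B: "bounded_clinear B" "\<And>x y. cinner (A x) y = cinner x (B y)"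
    using adjoint_exists[OF assms] by blast
  then have "adj A = B" by (rule adj_eqI)
  with B show "bounded_clinear (adj A)" "cinner (A x) y = cinner x (adj A y)"
    "cinner (adj A x) y = cinner x (A y)"
    by (auto simp: cinner_commute[of "B x" y] cinner_commute[of x "A y"])
qed

section \<open>Positive square roots\<close>

text \<open>Polarisation: the form f vanishes on the diagonal because \<open>positive_op\<close>
  includes reality. Expanding it at x + y and at x + i y gives f x y = - f y x and f x y = f y
  x.\<close>

lemma positive_op_selfadjoint:
  assumes S: "bounded_clinear S" and pos: "positive_op S"
  shows "cinner (S x) y = cinner x (S y)"
proof -
  interpret bounded_linear S by (rule bounded_clinear_bounded_linear[OF S])
  define f where "f = (\<lambda>x y. cinner (S x) y - cinner x (S y))"
  have f_add: "f (x + y) (x + y) = f x x + f x y + f y x + f y y" for x y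
    by (simp add: f_def add cinner_simps)
  have f_0: "f h h = 0" for h
  proof -
    have "cinner h (S h) = cnj (cinner (S h) h)"
      by (rule cinner_commute)
    then show ?thesis
      using pos by (simp add: f_def positive_op_def Reals_cnj_iff)
  qed
  have "f x y + f y x = 0"
    using f_add[of x y] by (simp add: f_0)
  moreover have "f x (\<i> *\<^sub>C y) + f (\<i> *\<^sub>C y) x = 0"
    using f_add[of x "\<i> *\<^sub>C y"] by (simp add: f_0)
  then have "\<i> * (f y x - f x y) = 0"
    by (simp add: f_def bounded_clinear_scaleC[OF S] cinner_simps algebra_simps)
  ultimately have "f x y = 0"
    by simp
  then show ?thesis
    by (simp add: f_def)
qed

text \<open>Along the line y + t S y the quadratic form of S is nonnegative and has no constant
  term, and its linear coefficient is twice the square of the norm of S y.\<close>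

lemma positive_op_eq_0:
  assumes S: "bounded_clinear S" and pos: "positive_op S" and 0: "Re (cinner (S y) y) = 0"
  shows "S y = 0"
proof -
  interpret bounded_linear S by (rule bounded_clinear_bounded_linear[OF S])
  have "inner (S y) (S y) = 0"
  proof (rule nonneg_quadratic_imp_zero)
    fix t :: real
    define z where "z = y + t *\<^sub>R S y"
    have "inner (S (S y)) y = inner (S y) (S y)" "inner (S y) y = 0"
      using positive_op_selfadjoint[OF S pos] 0 by (simp_all add: inner_eq_Re_cinner)
    then have "inner (S z) z = 2 * t * inner (S y) (S y) + t\<^sup>2 * inner (S (S y)) (S y)"
      by (simp add: z_def add scaleR inner_simps power2_eq_square algebra_simps)
    moreover have "0 \<le> inner (S z) z"
      using pos by (simp add: positive_op_def inner_eq_Re_cinner)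
    ultimately show "0 \<le> 2 * t * inner (S y) (S y) + t\<^sup>2 * inner (S (S y)) (S y)"
      by simp
    show "0 \<le> inner (S (S y)) (S y)"
      using pos by (simp add: positive_op_def inner_eq_Re_cinner)
  qed
  then show ?thesis
    by simp
qed

text \<open>Completeness passes from here to the space of bounded operators, where the iteration
  below converges in norm.\<close>

instance chilbert_space \<subseteq> banach ..

text \<open>A fixed point y = (a + y^2) / 2 satisfies (1 - y)^2 = 1 - a, so 1 minus the limit is a
  square root of 1 - a.\<close>

fun root_iter :: "('a::real_normed_vector \<Rightarrow>\<^sub>L 'a) \<Rightarrow> nat \<Rightarrow> 'a \<Rightarrow>\<^sub>L 'a" where
  "root_iter a 0 = 0"
| "root_iter a (Suc n) = (1 / 2) *\<^sub>R (a + (root_iter a n o\<^sub>L root_iter a n))"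

text \<open>The scalar iteration dominates the operator iteration, and it converges because it is
  monotone.\<close>

fun root_iter_real :: "nat \<Rightarrow> real" where
  "root_iter_real 0 = 0"
| "root_iter_real (Suc n) = (1 / 2) * (1 + (root_iter_real n)\<^sup>2)"

lemma root_iter_real_bounds: "0 \<le> root_iter_real n \<and> root_iter_real n \<le> 1"
proof (induction n)
  case (Suc n)
  then have "(root_iter_real n)\<^sup>2 \<le> 1\<^sup>2"
    by (intro power_mono) auto
  then show ?case
    by simp
qed simp

lemma incseq_root_iter_real: "incseq root_iter_real"
proof (rule incseq_SucI)
  fix n
  have "0 \<le> (1 / 2) * (1 - root_iter_real n)\<^sup>2"
    by simp
  also have "\<dots> = root_iter_real (Suc n) - root_iter_real n"
    by (simp add: power2_eq_square field_simps)
  finally show "root_iter_real n \<le> root_iter_real (Suc n)"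
    by simp
qed

lemma summable_root_iter_real_diff: "summable (\<lambda>n. root_iter_real (Suc n) - root_iter_real n)"
proof -
  obtain L where "root_iter_real \<longlonglongrightarrow> L"
    using incseq_convergent[OF incseq_root_iter_real] root_iter_real_bounds by blast
  then show ?thesis
    by (rule telescope_summable)
qed

lemma norm_root_iter:
  assumes a: "norm a \<le> 1"
  shows "norm (root_iter a n) \<le> root_iter_real n"
proof (induction n)
  case (Suc n)
  have "norm (a + (root_iter a n o\<^sub>L root_iter a n)) \<le> 1 + (root_iter_real n)\<^sup>2"
  proof (intro norm_triangle_mono a)
    have "norm (root_iter a n o\<^sub>L root_iter a n) \<le> norm (root_iter a n) * norm (root_iter a n)"
      by (rule norm_blinfun_compose)
    also have "\<dots> \<le> (root_iter_real n)\<^sup>2"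
      unfolding power2_eq_square using Suc root_iter_real_bounds[of n] by (intro mult_mono) auto
    finally show "norm (root_iter a n o\<^sub>L root_iter a n) \<le> (root_iter_real n)\<^sup>2" .
  qed
  then show ?case
    by simp
qed simp

text \<open>With d = y' - y, the difference of the squares of y' and y is y' d + d y, without any
  commutation. Its norm estimate reproduces the scalar recursion, whose differences
  telescope.\<close>

lemma norm_root_iter_diff:
  assumes a: "norm a \<le> 1"
  shows "norm (root_iter a (Suc n) - root_iter a n) \<le> root_iter_real (Suc n) - root_iter_real n"
proof (induction n)
  case 0
  show ?case
    using a by simp
next
  case (Suc n)
  let ?y = "root_iter a" and ?r = root_iter_real
  let ?d = "?y (Suc n) - ?y n" and ?e = "?r (Suc n) - ?r n"
  have "?y (Suc (Suc n)) - ?y (Suc n) = (1 / 2) *\<^sub>R ((?y (Suc n) o\<^sub>L ?y (Suc n)) - (?y n o\<^sub>L ?y n))"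
    by (subst root_iter.simps(2), subst (3) root_iter.simps(2))
      (simp only: scaleR_diff_right[symmetric] add_diff_cancel_left)
  also have "\<dots> = (1 / 2) *\<^sub>R ((?y (Suc n) o\<^sub>L ?d) + (?d o\<^sub>L ?y n))"
    by (simp only: bounded_bilinear.diff_left[OF bounded_bilinear_blinfun_compose]
        bounded_bilinear.diff_right[OF bounded_bilinear_blinfun_compose]) simp
  finally have "norm (?y (Suc (Suc n)) - ?y (Suc n)) =
      (1 / 2) * norm ((?y (Suc n) o\<^sub>L ?d) + (?d o\<^sub>L ?y n))"
    by (simp only: norm_scaleR)
  also have "\<dots> \<le> (1 / 2) * (?r (Suc n) * ?e + ?e * ?r n)"
  proof (intro mult_left_mono order_trans[OF norm_triangle_ineq] add_mono)
    have e: "0 \<le> ?e"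
      using incseq_root_iter_real by (simp add: incseq_Suc_iff)
    show "norm (?y (Suc n) o\<^sub>L ?d) \<le> ?r (Suc n) * ?e"
      by (rule order_trans[OF norm_blinfun_compose mult_mono[OF norm_root_iter[OF a] Suc.IH]])
         (use root_iter_real_bounds[of "Suc n"] in \<open>simp_all del: root_iter.simps\<close>)
    show "norm (?d o\<^sub>L ?y n) \<le> ?e * ?r n"
      by (rule order_trans[OF norm_blinfun_compose mult_mono[OF Suc.IH norm_root_iter[OF a] e]])
         simp
  qed simp
  also have "\<dots> = (1 / 2) * (?r (Suc n) * ?r (Suc n) - ?r n * ?r n)"
    by (simp only: algebra_simps)
  also have "\<dots> = ?r (Suc (Suc n)) - ?r (Suc n)"
    by (simp only: root_iter_real.simps(2)[of "Suc n"] root_iter_real.simps(2)[of n]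
        power2_eq_square right_diff_distrib[symmetric] add_diff_cancel_left)
  finally show ?case .
qed

text \<open>The clause on operators B commuting with A prepares uniqueness: any second root commutes
  with A, hence with this S.\<close>

lemma positive_root_exists:
  fixes A :: "'a::chilbert_space \<Rightarrow> 'a"
  assumes A: "bounded_clinear A" and sa: "\<And>x y. cinner (A x) y = cinner x (A y)"
    and le: "\<And>x. norm (A x) \<le> norm x"
  shows "\<exists>S. bounded_clinear S \<and> positive_op S \<and> S \<circ> S = (\<lambda>x. x - A x) \<and>
    (\<forall>B. bounded_linear B \<and> (\<forall>x. B (A x) = A (B x)) \<longrightarrow> (\<forall>x. B (S x) = S (B x)))"
proof -
  define a where "a = Blinfun A"
  have apply_a: "blinfun_apply a = A"
    by (simp add: a_def bounded_linear_Blinfun_apply bounded_clinear_bounded_linear[OF A])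
  have norm_a: "norm a \<le> 1"
    by (rule norm_blinfun_bound) (simp_all add: apply_a le)
  let ?y = "root_iter a"
  have "summable (\<lambda>n. ?y (Suc n) - ?y n)"
    by (rule summable_comparison_test'[OF summable_root_iter_real_diff])
       (rule norm_root_iter_diff[OF norm_a])
  then obtain l where "(\<lambda>n. \<Sum>i<n. ?y (Suc i) - ?y i) \<longlonglongrightarrow> l"
    by (auto simp: summable_def sums_def)
  then have lim: "?y \<longlonglongrightarrow> l"
    by (simp add: sum_lessThan_telescope del: root_iter.simps(2))
  have "(\<lambda>n. ?y (Suc n)) \<longlonglongrightarrow> (1 / 2) *\<^sub>R (a + (l o\<^sub>L l))"
    unfolding root_iter.simps(2)
    by (intro tendsto_scaleR tendsto_add tendsto_const lim
        bounded_bilinear.tendsto[OF bounded_bilinear_blinfun_compose])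
  then have "l = (1 / 2) *\<^sub>R (a + (l o\<^sub>L l))"
    using LIMSEQ_unique LIMSEQ_Suc[OF lim] by blast
  from arg_cong[OF this, of "(*\<^sub>R) 2"] have "2 *\<^sub>R l = a + (l o\<^sub>L l)"
    by simp
  then have fixpoint: "2 *\<^sub>R l x = A x + l (l x)" for x
    by (metis apply_a blinfun.add_left blinfun.scaleR_left blinfun_apply_blinfun_compose)
  have lim_x: "(\<lambda>n. ?y n x) \<longlonglongrightarrow> l x" for x
    by (intro blinfun.tendsto lim tendsto_const)
  have norm_l: "norm (l x) \<le> norm x" for x
  proof (rule LIMSEQ_le_const2[OF tendsto_norm[OF lim_x]])
    show "\<exists>N. \<forall>n\<ge>N. norm (?y n x) \<le> norm x"
    proof (intro exI allI impI)
      fix n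
      have "norm (?y n) \<le> 1"
        using norm_root_iter[OF norm_a, of n] root_iter_real_bounds[of n] by simp
      then show "norm (?y n x) \<le> norm x"
        using norm_blinfun[of "?y n" x] mult_right_mono[of "norm (?y n)" 1 "norm x"] by simp
    qed
  qed
  have comm: "B (l x) = l (B x)"
    if B: "bounded_linear B" and BA: "\<And>x. B (A x) = A (B x)" for B x
  proof -
    interpret B: bounded_linear B by (rule B)
    have "B (?y n x) = ?y n (B x)" for n x
    proof (induction n arbitrary: x)
      case (Suc n)
      then show ?case
        by (simp add: blinfun.add_left blinfun.scaleR_left B.add B.scaleR apply_a BA)
    qed (simp add: B.zero)
    then have "(\<lambda>n. ?y n (B x)) \<longlonglongrightarrow> B (l x)"
      using B.tendsto[OF lim_x[of x]] by simp
    then show ?thesis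
      using LIMSEQ_unique lim_x by blast
  qed
  have sa_y: "inner (?y n x) z = inner x (?y n z)" for n x z
  proof (induction n arbitrary: x z)
    case (Suc n)
    have "inner (A x) z = inner x (A z)"
      by (simp add: inner_eq_Re_cinner sa)
    with Suc show ?case
      by (simp add: blinfun.add_left blinfun.scaleR_left inner_simps apply_a)
  qed simp
  have sa_l: "inner (l x) z = inner x (l z)" for x z
  proof (rule LIMSEQ_unique)
    show "(\<lambda>n. inner (?y n x) z) \<longlonglongrightarrow> inner (l x) z"
      by (intro tendsto_inner lim_x tendsto_const)
    show "(\<lambda>n. inner (?y n x) z) \<longlonglongrightarrow> inner x (l z)"
      unfolding sa_y by (intro tendsto_inner lim_x tendsto_const)
  qed
  define S where "S = (\<lambda>x. x - l x)"
  \<comment> \<open>The iterates are typed as real linear maps only. Multiplication by c commutes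
    with A and therefore with the limit, which gives complex homogeneity.\<close>
  have lC: "l (c *\<^sub>C x) = c *\<^sub>C l x" for c x
    using comm[OF bounded_linear_scaleC, of c x] bounded_clinear_scaleC[OF A] by simp
  have S: "bounded_clinear S"
    unfolding bounded_clinear_def S_def
    by (auto intro!: bounded_linear_sub bounded_linear_ident blinfun.bounded_linear_right
        simp: lC complex_vector.scale_right_diff_distrib)
  have cl: "bounded_clinear (blinfun_apply l)"
    by (simp add: bounded_clinear_def blinfun.bounded_linear_right lC)
  have "positive_op S"
    unfolding positive_op_def
  proof (intro allI conjI)
    fix h
    have "cinner (S h) h = cinner h (S h)"
      using cinner_adjoint_of_inner_adjoint[OF cl sa_l, of h h] by (simp add: S_def cinner_simps)
    then have "cnj (cinner (S h) h) = cinner (S h) h"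
      using cinner_commute[of h "S h"] by simp
    then show "cinner (S h) h \<in> \<real>"
      by (simp add: Reals_cnj_iff)
    have "inner (l h) h \<le> norm h * norm h"
      by (rule order_trans[OF norm_cauchy_schwarz mult_right_mono[OF norm_l]]) simp
    then show "0 \<le> Re (cinner (S h) h)"
      by (simp add: S_def cinner_diff_left cinner_self inner_eq_Re_cinner power2_eq_square)
  qed
  moreover have "S \<circ> S = (\<lambda>x. x - A x)"
  proof
    fix x
    have "(S \<circ> S) x = x - 2 *\<^sub>R l x + l (l x)"
      by (simp add: S_def blinfun.diff_right scaleR_2)
    then show "(S \<circ> S) x = x - A x"
      by (simp add: fixpoint)
  qed
  moreover have "B (S x) = S (B x)"
    if "bounded_linear B" "\<And>x. B (A x) = A (B x)" for B x
    using comm[OF that] by (simp add: S_def linear_diff bounded_linear.linear[OF that(1)])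
  ultimately show ?thesis
    using S by blast
qed

text \<open>For y = R x - S x, commutation gives R y + S y = R R x - S S x = 0. Both nonnegative
  forms then vanish at y, so R y = S y = 0, and by selfadjointness y is orthogonal to R x and S x,
  hence to itself.\<close>

lemma positive_root_unique:
  fixes R S :: "'a::complex_inner \<Rightarrow> 'a"
  assumes R: "bounded_clinear R" "positive_op R" and S: "bounded_clinear S" "positive_op S"
    and eq: "\<And>x. R (R x) = S (S x)" and comm: "\<And>x. R (S x) = S (R x)"
  shows "R = S"
proof
  fix x
  interpret R: bounded_linear R by (rule bounded_clinear_bounded_linear[OF R(1)])
  interpret S: bounded_linear S by (rule bounded_clinear_bounded_linear[OF S(1)])
  define y where "y = R x - S x"
  have "R y + S y = 0"
    by (simp add: y_def R.diff S.diff eq comm)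
  then have "Re (cinner (R y) y) + Re (cinner (S y) y) = 0"
    using cinner_add_left[of "R y" "S y" y] by (simp flip: plus_complex.sel(1))
  moreover have "0 \<le> Re (cinner (R y) y)" "0 \<le> Re (cinner (S y) y)"
    using R(2) S(2) by (auto simp: positive_op_def)
  ultimately have "Re (cinner (R y) y) = 0" "Re (cinner (S y) y) = 0"
    by simp_all
  then have "R y = 0" "S y = 0"
    using positive_op_eq_0 R S by blast+
  then have "cinner (R x) y = 0" "cinner (S x) y = 0"
    using positive_op_selfadjoint[OF R, of x y] positive_op_selfadjoint[OF S, of x y] by simp_all
  then have "cinner (R x - S x) y = 0"
    by (simp add: cinner_diff_left)
  then have "cinner y y = 0"
    by (simp add: y_def)
  then show "R x = S x"
    unfolding cinner_self_eq_0_iff by (simp add: y_def)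
qed

lemma
  fixes A :: "'a::chilbert_space \<Rightarrow> 'a"
  assumes A: "bounded_clinear A" and sa: "\<And>x y. cinner (A x) y = cinner x (A y)"
    and le: "\<And>x. norm (A x) \<le> norm x"
  shows bounded_clinear_sqrt_op: "bounded_clinear (sqrt_op (\<lambda>x. x - A x))" (is ?P1)
    and positive_op_sqrt_op: "positive_op (sqrt_op (\<lambda>x. x - A x))" (is ?P2)
    and sqrt_op_sqrt_op: "sqrt_op (\<lambda>x. x - A x) (sqrt_op (\<lambda>x. x - A x) x) = x - A x" (is ?P3)
proof -
  obtain S where S: "bounded_clinear S" "positive_op S" "S \<circ> S = (\<lambda>x. x - A x)"
    and comm: "\<And>B x. bounded_linear B \<Longrightarrow> (\<And>x. B (A x) = A (B x)) \<Longrightarrow> B (S x) = S (B x)"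
    using positive_root_exists[OF assms] by blast
  have "R = S" if R: "bounded_clinear R \<and> positive_op R \<and> R \<circ> R = (\<lambda>x. x - A x)" for R
  proof (rule positive_root_unique)
    interpret R: bounded_linear R by (rule bounded_clinear_bounded_linear) (use R in blast)
    have RR: "R (R x) = x - A x" for x
      using R by (metis comp_apply)
    \<comment> \<open>Both sides equal \<open>R (R (R x))\<close>; so R commutes with A and thereby
      with S.\<close>
    have "R (x - A x) = R x - A (R x)" for x
      by (metis RR)
    then have "R (A x) = A (R x)" for x
      by (simp add: R.diff)
    then show "R (S x) = S (R x)" for x
      by (rule comm[OF R.bounded_linear_axioms])
    show "R (R x) = S (S x)" for x
      using RR S(3) by (metis comp_apply)
  qed (use R S in auto)
  then have root: "sqrt_op (\<lambda>x. x - A x) = S"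
    unfolding sqrt_op_def by (intro the_equality conjI S) blast
  show ?P1 ?P2 ?P3
    unfolding root using S by (simp_all flip: comp_apply[of S S])
qed

section \<open>Defect spaces and the self-commutator\<close>

text \<open>Being orthogonal to the closed range of the selfadjoint root S means S x = 0, and S (S
  x) = 0 already implies this through \<open>cinner (S x) (S x)\<close> = 0. The root can thus be
  traded for its square I - A.\<close>

lemma orthogonal_defect_iff:
  fixes A :: "'a::chilbert_space \<Rightarrow> 'a"
  assumes A: "bounded_clinear A" and sa: "\<And>x y. cinner (A x) y = cinner x (A y)"
    and le: "\<And>x. norm (A x) \<le> norm x"
  shows "(\<forall>y\<in>closure (range (sqrt_op (\<lambda>x. x - A x))). cinner x y = 0) \<longleftrightarrow> A x = x"
proof -
  define S where "S = sqrt_op (\<lambda>x. x - A x)"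
  have S: "bounded_clinear S" "positive_op S" and SS: "\<And>x. S (S x) = x - A x"
    unfolding S_def
    using bounded_clinear_sqrt_op[OF assms] positive_op_sqrt_op[OF assms] sqrt_op_sqrt_op[OF assms]
    by blast+
  note saS = positive_op_selfadjoint[OF S]
  have "S (S x) = 0 \<longleftrightarrow> S x = 0"
  proof
    assume "S (S x) = 0"
    then have "cinner (S x) (S x) = 0"
      by (simp add: saS)
    then show "S x = 0"
      by (simp add: cinner_self_eq_0_iff)
  qed (simp add: linear_0 bounded_linear.linear bounded_clinear_bounded_linear[OF S(1)])
  then have Sx: "A x = x \<longleftrightarrow> S x = 0"
    by (auto simp: SS)
  have "closed {y. cinner x y = 0}"
    by (intro closed_Collect_eq linear_continuous_on bounded_linear_cinner_right continuous_on_const)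
  then have "(\<forall>y\<in>closure (range S). cinner x y = 0) \<longleftrightarrow> (\<forall>y\<in>range S. cinner x y = 0)"
    using closure_minimal[of "range S" "{y. cinner x y = 0}"] closure_subset[of "range S"] by blast
  also have "\<dots> \<longleftrightarrow> S x = 0"
    using cinner_eqI[of "S x" 0] by (auto simp flip: saS)
  finally show ?thesis
    unfolding S_def[symmetric] Sx .
qed

lemma diff_mem_defect:
  fixes A :: "'a::chilbert_space \<Rightarrow> 'a"
  assumes A: "bounded_clinear A" and sa: "\<And>x y. cinner (A x) y = cinner x (A y)"
    and le: "\<And>x. norm (A x) \<le> norm x"
  shows "x - A x \<in> closure (range (sqrt_op (\<lambda>x. x - A x)))"
  by (rule subsetD[OF closure_subset]) (metis sqrt_op_sqrt_op[OF assms] rangeI)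

lemma bounded_clinear_comp:
  assumes "bounded_clinear A" "bounded_clinear B"
  shows "bounded_clinear (\<lambda>x. A (B x))"
  using assms bounded_linear_compose[of A B] by (simp add: bounded_clinear_def)

lemma norm_adj_le:
  fixes T :: "'a::chilbert_space \<Rightarrow> 'a"
  assumes "contraction T"
  shows "norm (adj T x) \<le> norm x"
proof (cases "adj T x = 0")
  case False
  have T: "bounded_clinear T" and le: "\<And>h. norm (T h) \<le> norm h"
    using assms by (auto simp: contraction_def)
  have "norm (adj T x) * norm (adj T x) = cmod (cinner (T (adj T x)) x)"
    by (simp add: cinner_adj[OF T] cinner_self norm_mult power2_eq_square)
  also have "\<dots> \<le> norm (T (adj T x)) * norm x"
    by (rule cmod_cinner_le)
  also have "\<dots> \<le> norm (adj T x) * norm x"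
    by (intro mult_right_mono le) simp
  finally show ?thesis
    using False by (simp add: mult_le_cancel_left)
qed simp

context
  fixes T :: "'a::chilbert_space \<Rightarrow> 'a"
  assumes contr: "contraction T"
begin

lemma bounded_clinear_contraction: "bounded_clinear T"
  using contr by (simp add: contraction_def)

lemma norm_contraction: "norm (T h) \<le> norm h"
  using contr by (simp add: contraction_def)

lemma orthogonal_defect_space_iff:
  "(\<forall>y\<in>defect_space T. cinner x y = 0) \<longleftrightarrow> adj T (T x) = x"
  unfolding defect_space_def
proof (rule orthogonal_defect_iff)
  show "bounded_clinear (\<lambda>x. adj T (T x))"
    by (rule bounded_clinear_comp[OF bounded_clinear_adj])
       (rule bounded_clinear_contraction)+
  show "cinner (adj T (T x)) y = cinner x (adj T (T y))" for x y
    by (simp add: cinner_adj[symmetric] cinner_adj' bounded_clinear_contraction)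
  show "norm (adj T (T x)) \<le> norm x" for x
    by (rule order_trans[OF norm_adj_le[OF contr] norm_contraction])
qed

lemma diff_mem_defect_space_adj: "x - T (adj T x) \<in> defect_space_adj T"
  unfolding defect_space_adj_def
proof (rule diff_mem_defect)
  show "bounded_clinear (\<lambda>x. T (adj T x))"
    by (rule bounded_clinear_comp[OF _ bounded_clinear_adj])
       (rule bounded_clinear_contraction)+
  show "cinner (T (adj T x)) y = cinner x (T (adj T y))" for x y
    by (simp add: cinner_adj cinner_adj'[symmetric] bounded_clinear_contraction)
  show "norm (T (adj T x)) \<le> norm x" for x
    by (rule order_trans[OF norm_contraction norm_adj_le[OF contr]])
qed

end

lemma rank_one_sum_orthonormal:
  assumes "orthonormal_family n e" "i < n"
  shows "(\<Sum>j<n. c j *\<^sub>C rank_one (e j) (e j) (e i)) = c i *\<^sub>C e i"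
proof -
  have "(\<Sum>j<n. c j *\<^sub>C rank_one (e j) (e j) (e i)) =
      (\<Sum>j<n. if j = i then c i *\<^sub>C e i else 0)"
    using assms by (intro sum.cong refl) (auto simp: orthonormal_family_def rank_one_def)
  then show ?thesis
    using assms(2) by simp
qed

lemma has_rank_rank_one_sum:
  assumes e: "orthonormal_family n e" and c: "\<And>i. i < n \<Longrightarrow> c i \<noteq> 0"
  shows "has_rank (\<lambda>h. \<Sum>j<n. c j *\<^sub>C rank_one (e j) (e j) h) n" (is "has_rank ?A n")
proof -
  have inj: "inj_on e {..<n}"
  proof (rule inj_onI)
    fix i j
    assume "i \<in> {..<n}" "j \<in> {..<n}" "e i = e j"
    then show "i = j"
      using e unfolding orthonormal_family_def by (metis lessThan_iff zero_neq_one)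
  qed
  have "complex_vector.independent (e ` {..<n})"
    unfolding complex_vector.dependent_finite[OF finite_imageI[OF finite_lessThan]]
  proof safe
    fix u i
    assume 0: "(\<Sum>v\<in>e ` {..<n}. u v *\<^sub>C v) = 0" and i: "i < n" "u (e i) \<noteq> 0"
    have "0 = cinner (\<Sum>j<n. u (e j) *\<^sub>C e j) (e i)"
      using 0 by (simp add: sum.reindex[OF inj])
    also have "\<dots> = (\<Sum>j<n. if j = i then u (e i) else 0)"
      unfolding cinner_sum_left
      using e i by (intro sum.cong refl) (auto simp: orthonormal_family_def cinner_scaleC_left)
    finally show False
      using i by simp
  qed
  moreover have "complex_vector.span (e ` {..<n}) = range ?A"
  proof
    have "complex_vector.subspace (range ?A)"
      unfolding complex_vector.subspace_def
    proof (intro conjI ballI allI)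
      show "0 \<in> range ?A"
        by (rule range_eqI[of _ _ 0]) (simp add: rank_one_def)
    next
      fix x y
      assume "x \<in> range ?A" "y \<in> range ?A"
      then obtain u v where "x = ?A u" "y = ?A v"
        by blast
      then have "x + y = ?A (u + v)"
        by (simp add: rank_one_def cinner_add_left scaleC_add_left scaleC_add_right sum.distrib)
      then show "x + y \<in> range ?A"
        by blast
    next
      fix k x
      assume "x \<in> range ?A"
      then obtain u where "x = ?A u"
        by blast
      then have "k *\<^sub>C x = ?A (k *\<^sub>C u)"
        by (simp add: rank_one_def cinner_scaleC_left complex_vector.scale_sum_right scaleC_scaleC
            mult.left_commute)
      then show "k *\<^sub>C x \<in> range ?A"
        by blast
    qed
    moreover have "e i \<in> range ?A" if "i < n" for i
    proof (rule range_eqI)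
      have "?A (inverse (c i) *\<^sub>C e i) = (\<Sum>j<n. (c j * inverse (c i)) *\<^sub>C rank_one (e j) (e j) (e i))"
        by (simp add: rank_one_def cinner_scaleC_left scaleC_scaleC mult.assoc)
      also have "\<dots> = (c i * inverse (c i)) *\<^sub>C e i"
        by (rule rank_one_sum_orthonormal[OF e that])
      also have "c i * inverse (c i) = 1"
        by (rule right_inverse[OF c[OF that]])
      finally show "e i = ?A (inverse (c i) *\<^sub>C e i)"
        by simp
    qed
    then have "e ` {..<n} \<subseteq> range ?A"
      by (intro image_subsetI) simp
    ultimately show "complex_vector.span (e ` {..<n}) \<subseteq> range ?A"
      by (intro complex_vector.span_minimal)
    show "range ?A \<subseteq> complex_vector.span (e ` {..<n})"
      unfolding rank_one_def
      by (intro image_subsetI complex_vector.span_sum complex_vector.span_scale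
          complex_vector.span_base) simp
  qed
  ultimately show ?thesis
    unfolding has_rank_def using card_image[OF inj] by (intro exI[of _ "e ` {..<n}"]) simp
qed

text \<open>This removes square roots, rank and range from the notion: positivity, rank n and the
  range inclusion all follow from the diagonal form with positive weights, and orthogonality to D_T
  becomes the fixed point equation for e i.\<close>

lemma n_finite_decomp_iff:
  fixes T :: "'a::chilbert_space \<Rightarrow> 'a"
  shows "n_finite n T \<and> self_comm_decomp n T e \<alpha> \<longleftrightarrow>
    contraction T \<and> orthonormal_family n e \<and> \<alpha> ` {..<n} \<subseteq> {0<..1} \<and>
    (\<forall>i<n. adj T (T (e i)) = e i) \<and>
    self_comm T = (\<lambda>h. \<Sum>j<n. complex_of_real (\<alpha> j) *\<^sub>C rank_one (e j) (e j) h)"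
    (is "?L \<longleftrightarrow> ?R")
proof
  assume L: ?L
  then have "adj T (T (e i)) = e i" if "i < n" for i
    using that orthogonal_defect_space_iff[of T "e i"]
    by (auto simp: n_finite_def self_comm_decomp_def ominus_def)
  with L show ?R
    by (auto simp: n_finite_def self_comm_decomp_def)
next
  assume R: ?R
  then have contr: "contraction T" and e: "orthonormal_family n e"
    and \<alpha>: "\<And>i. i < n \<Longrightarrow> 0 < \<alpha> i" and Te: "\<And>i. i < n \<Longrightarrow> adj T (T (e i)) = e i"
    and sc: "self_comm T = (\<lambda>h. \<Sum>j<n. complex_of_real (\<alpha> j) *\<^sub>C rank_one (e j) (e j) h)"
    by auto
  have T: "bounded_clinear T"
    by (rule bounded_clinear_contraction[OF contr])
  interpret T: bounded_linear T
    by (rule bounded_clinear_bounded_linear[OF T])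
  interpret adj: bounded_linear "adj T"
    by (rule bounded_clinear_bounded_linear[OF bounded_clinear_adj[OF T]])
  \<comment> \<open>I - T T* and the self-commutator agree on e i, because T*T fixes it.\<close>
  have ev: "e i - T (adj T (e i)) = complex_of_real (\<alpha> i) *\<^sub>C e i" if "i < n" for i
    using fun_cong[OF sc, of "e i"] Te[OF that] rank_one_sum_orthonormal[OF e that]
    by (simp add: self_comm_def)
  have comb: "(\<Sum>j<n. c j *\<^sub>C e j) \<in> defect_space_adj T \<ominus>\<^sub>H defect_space T" for c
  proof -
    let ?x = "\<Sum>j<n. c j *\<^sub>C e j"
    \<comment> \<open>Dividing each coefficient by the eigenvalue presents x as the image of y under
      I - T T*, which lies in the range of the square of the root.\<close>
    let ?y = "\<Sum>j<n. (c j / complex_of_real (\<alpha> j)) *\<^sub>C e j"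
    have "?y - T (adj T ?y) = (\<Sum>j<n. (c j / complex_of_real (\<alpha> j)) *\<^sub>C (e j - T (adj T (e j))))"
      by (simp add: T.sum adj.sum bounded_clinear_scaleC[OF T]
          bounded_clinear_scaleC[OF bounded_clinear_adj[OF T]]
          complex_vector.scale_right_diff_distrib sum_subtractf)
    also have "\<dots> = ?x"
      using \<alpha> by (intro sum.cong refl) (force simp: ev scaleC_scaleC)
    finally have "?x \<in> defect_space_adj T"
      using diff_mem_defect_space_adj[OF contr, of ?y] by simp
    moreover have "adj T (T ?x) = ?x"
      by (simp add: T.sum adj.sum bounded_clinear_scaleC[OF T] Te
          bounded_clinear_scaleC[OF bounded_clinear_adj[OF T]])
    ultimately show ?thesis
      using orthogonal_defect_space_iff[OF contr, of ?x] by (simp add: ominus_def)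
  qed
  have "e ` {..<n} \<subseteq> defect_space_adj T \<ominus>\<^sub>H defect_space T"
  proof (intro image_subsetI)
    fix i
    assume "i \<in> {..<n}"
    then have "e i = (\<Sum>j<n. (if j = i then 1 else 0) *\<^sub>C e j)"
      by (simp add: if_distrib[of "\<lambda>c. c *\<^sub>C _"] cong: if_cong)
    then show "e i \<in> defect_space_adj T \<ominus>\<^sub>H defect_space T"
      using comb[of "\<lambda>j. if j = i then 1 else 0"] by simp
  qed
  moreover have "range (self_comm T) \<subseteq> defect_space_adj T \<ominus>\<^sub>H defect_space T"
    unfolding sc rank_one_def scaleC_scaleC by (intro image_subsetI comb)
  moreover have "hyponormal T"
    unfolding hyponormal_def positive_op_def
  proof (intro conjI allI T)
    fix h
    have "cinner (self_comm T h) h = (\<Sum>j<n. complex_of_real (\<alpha> j * (cmod (cinner h (e j)))\<^sup>2))"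
      unfolding sc cinner_sum_left rank_one_def
      by (intro sum.cong refl)
         (simp add: cinner_scaleC_left cinner_commute[of "e _" h] complex_norm_square del: of_real_power)
    then have "cinner (self_comm T h) h = complex_of_real (\<Sum>j<n. \<alpha> j * (cmod (cinner h (e j)))\<^sup>2)"
      by simp
    moreover have "0 \<le> (\<Sum>j<n. \<alpha> j * (cmod (cinner h (e j)))\<^sup>2)"
      using \<alpha> by (intro sum_nonneg mult_nonneg_nonneg) (auto intro: less_imp_le)
    ultimately show "cinner (self_comm T h) h \<in> \<real>" "0 \<le> Re (cinner (self_comm T h) h)"
      by simp_all
  qed
  moreover have "has_rank (self_comm T) n"
    unfolding sc by (rule has_rank_rank_one_sum[OF e]) (use \<alpha> in force)
  ultimately show ?L
    unfolding n_finite_def self_comm_decomp_def using R by blast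
qed

section \<open>The Hardy space\<close>

text \<open>The inverse of the coefficient map, meaningful for square-summable sequences. The value
  0 off the disc matches the representation of \<open>hardy\<close>.\<close>

definition hardy_of :: "(nat \<Rightarrow> complex) \<Rightarrow> hardy" where
  "hardy_of a = Abs_hardy (\<lambda>z. if z \<in> ball 0 1 then eval_fps (Abs_fps a) z else 0)"

text \<open>Square-summable coefficients are bounded, so a geometric series dominates the power
  series inside the disc and its radius of convergence is at least 1.\<close>

lemma hcoeff_hardy_of:
  assumes a: "summable (\<lambda>k. (cmod (a k))\<^sup>2)"
  shows "hcoeff (hardy_of a) k = a k"
proof -
  let ?f = "\<lambda>z. if z \<in> ball 0 1 then eval_fps (Abs_fps a) z else 0"
  have "(\<lambda>k. cmod (a k)) \<longlonglongrightarrow> 0"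
    using tendsto_real_sqrt[OF summable_LIMSEQ_zero[OF a]] by simp
  then have "Bseq a"
    using convergentI convergent_imp_Bseq tendsto_norm_zero_iff by blast
  then obtain K where K: "\<And>k. norm (a k) \<le> K"
    by (auto simp: Bseq_def)
  have "summable (\<lambda>k. a k * z ^ k)" if "norm z < 1" for z
  proof (rule summable_comparison_test')
    show "summable (\<lambda>k. K * norm z ^ k)"
      using that by (intro summable_mult summable_geometric) simp
    show "norm (a k * z ^ k) \<le> K * norm z ^ k" if "0 \<le> k" for k
      by (simp add: norm_mult norm_power mult_right_mono K)
  qed
  then have le: "1 \<le> fps_conv_radius (Abs_fps a)"
    unfolding fps_conv_radius_def by (intro conv_radius_geI_ex') (auto simp: one_ereal_def)
  have rad: "0 < fps_conv_radius (Abs_fps a)"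
    by (rule less_le_trans[OF _ le]) simp
  have sub: "ball (0 :: complex) 1 \<subseteq> eball 0 (fps_conv_radius (Abs_fps a))"
  proof (rule subsetI)
    fix z :: complex
    assume "z \<in> ball 0 1"
    then have "ereal (dist 0 z) < 1"
      by (simp add: one_ereal_def)
    then show "z \<in> eball 0 (fps_conv_radius (Abs_fps a))"
      unfolding in_eball_iff using le by (rule order.strict_trans2)
  qed
  have coeff: "taylor_coeff ?f k = a k" for k
  proof -
    have "(deriv ^^ k) ?f 0 = (deriv ^^ k) (eval_fps (Abs_fps a)) 0"
    proof (rule higher_deriv_cong_ev)
      show "\<forall>\<^sub>F z in nhds 0. ?f z = eval_fps (Abs_fps a) z"
        by (rule eventually_mono[OF eventually_nhds_in_open[of "ball 0 1"]]) auto
    qed simp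
    then show ?thesis
      using fps_nth_conv_deriv[OF rad, of k] by (simp add: taylor_coeff_def)
  qed
  have "hardy_fun (hardy_of a) = ?f"
    unfolding hardy_of_def
  proof (rule Abs_hardy_inverse, intro CollectI conjI)
    show "?f holomorphic_on ball 0 1"
      by (rule holomorphic_transform[OF holomorphic_on_eval_fps[OF sub]]) auto
    show "summable (\<lambda>k. (cmod (taylor_coeff ?f k))\<^sup>2)"
      unfolding coeff by (rule a)
  qed auto
  then show ?thesis
    using coeff by simp
qed

lemma hcoeff_diff: "hcoeff (f - g) k = hcoeff f k - hcoeff g k"
  using hcoeff_add[of "f - g" g k] by simp

lemma hcoeff_sum: "hcoeff (\<Sum>i\<in>A. f i) k = (\<Sum>i\<in>A. hcoeff (f i) k)"
  by (induction A rule: infinite_finite_induct) (simp_all add: hcoeff_zero hcoeff_add)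

lemma hcoeff_Mz: "hcoeff (hardy_Mz f) k = (case k of 0 \<Rightarrow> 0 | Suc j \<Rightarrow> hcoeff f j)"
  by (simp add: hardy_fun_Mz taylor_coeff_mult_z hardy_holomorphic)

lemma hcoeff_const: "hcoeff (hardy_const c) k = (if k = 0 then c else 0)"
  unfolding hardy_fun_const by (rule taylor_coeff_const)

lemma cinner_hardy_const: "cinner f (hardy_const c) = hcoeff f 0 * cnj c"
proof -
  have "cinner f (hardy_const c) = (\<Sum>k\<in>{0}. hcoeff f k * cnj (hcoeff (hardy_const c) k))"
    unfolding cinner_hardy_def by (rule suminf_finite) (auto simp: hcoeff_const)
  then show ?thesis
    by (simp add: hcoeff_const)
qed

lemma hardy_PC_eq: "hardy_PC f = hardy_const (hcoeff f 0)"
  unfolding hardy_PC_def ortho_proj_def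
proof (rule the_equality)
  fix p
  assume p: "p \<in> range hardy_const \<and> (\<forall>y\<in>range hardy_const. cinner (f - p) y = 0)"
  then obtain c where c: "p = hardy_const c"
    by blast
  have "cinner (f - p) (hardy_const 1) = 0"
    using p by blast
  then show "p = hardy_const (hcoeff f 0)"
    by (simp add: cinner_hardy_const hcoeff_diff c hcoeff_const)
qed (auto simp: cinner_hardy_const hcoeff_diff hcoeff_const)

lemma summable_hcoeff_Suc: "summable (\<lambda>k. (cmod (hcoeff f (Suc k)))\<^sup>2)"
  using hardy_summable[of f] by (subst summable_Suc_iff)

text \<open>\<open>hardy\<close> is available as an inner product space only, outside the scope of
  \<open>adjoint_exists\<close>. The adjoint is therefore exhibited as the backward shift on
  coefficients and identified through \<open>adj_eqI\<close>.\<close>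

lemma
  shows hcoeff_adj_Mz: "hcoeff (adj hardy_Mz f) k = hcoeff f (Suc k)"
    and cinner_Mz: "cinner (hardy_Mz f) g = cinner f (adj hardy_Mz g)"
proof -
  define B where "B = (\<lambda>f. hardy_of (\<lambda>k. hcoeff f (Suc k)))"
  have hB: "hcoeff (B f) k = hcoeff f (Suc k)" for f k
    unfolding B_def by (rule hcoeff_hardy_of[OF summable_hcoeff_Suc])
  have BC: "B (c *\<^sub>C f) = c *\<^sub>C B f" for c f
    by (rule hcoeff_eqI) (simp add: hB hcoeff_scaleC)
  have "bounded_linear B"
  proof (rule bounded_linear_intro[where K = 1])
    show "B (f + g) = B f + B g" for f g
      by (rule hcoeff_eqI) (simp add: hB hcoeff_add)
    show "B (r *\<^sub>R f) = r *\<^sub>R B f" for r f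
      by (simp add: scaleR_scaleC BC)
    show "norm (B f) \<le> norm f * 1" for f
    proof -
      have sq: "(norm h)\<^sup>2 = (\<Sum>k. (cmod (hcoeff h k))\<^sup>2)" for h :: hardy
        by (simp add: power2_norm_eq_inner inner_eq_Re_cinner Re_cinner_self_hardy)
      have "(\<Sum>k. (cmod (hcoeff f (Suc k)))\<^sup>2) = (\<Sum>k. (cmod (hcoeff f k))\<^sup>2) - (cmod (hcoeff f 0))\<^sup>2"
        by (rule suminf_split_head[OF hardy_summable])
      then have "(norm (B f))\<^sup>2 \<le> (norm f)\<^sup>2"
        unfolding sq hB by simp
      then show ?thesis
        by (simp add: power2_le_iff_abs_le)
    qed
  qed
  then have "bounded_clinear B"
    by (simp add: bounded_clinear_def BC)
  moreover have adj: "cinner (hardy_Mz f) g = cinner f (B g)" for f g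
  proof -
    have "(\<Sum>k. hcoeff (hardy_Mz f) (Suc k) * cnj (hcoeff g (Suc k))) =
        (\<Sum>k. hcoeff (hardy_Mz f) k * cnj (hcoeff g k)) - hcoeff (hardy_Mz f) 0 * cnj (hcoeff g 0)"
      by (rule suminf_split_head[OF summable_hardy_prod])
    then show ?thesis
      by (simp add: cinner_hardy_def hB hcoeff_Mz)
  qed
  ultimately have "adj hardy_Mz = B"
    by (rule adj_eqI)
  with hB adj show "hcoeff (adj hardy_Mz f) k = hcoeff f (Suc k)"
    "cinner (hardy_Mz f) g = cinner f (adj hardy_Mz g)"
    by auto
qed

lemma Mz_adj_Mz: "hardy_Mz (adj hardy_Mz f) = f - hardy_PC f"
  by (rule hcoeff_eqI)
     (auto simp: hcoeff_adj_Mz hcoeff_Mz hardy_PC_eq hcoeff_diff hcoeff_const split: nat.split)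

section \<open>The model operators in coordinates\<close>

lemma D_tilde_mat_index:
  assumes "m \<le> n" "i < n" "j < m"
  shows "D_tilde_mat n m \<alpha> $$ (i, j) =
    (if i = j then complex_of_real (sqrt (1 - \<alpha> i)) else 0)"
  using assms
  by (auto simp: D_tilde_mat_def append_rows_def D_mat_def mat_diag_def)

lemma dim_D_tilde_mat: "m \<le> n \<Longrightarrow> dim_row (D_tilde_mat n m \<alpha>) = n" "dim_col (D_tilde_mat n m \<alpha>) = m"
  by (auto simp: D_tilde_mat_def append_rows_def D_mat_def mat_diag_def)

lemma tensor_op_one:
  "tensor_op A (1\<^sub>m n) F = Matrix.vec n (\<lambda>i. A (vec_index F i))"
  by (rule eq_vecI)
     (auto simp: tensor_op_def if_distrib[of "\<lambda>c. c *\<^sub>C _"] cong: if_cong)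

lemma tensor_op_D_mat:
  "tensor_op A (D_mat m \<alpha>) F =
    Matrix.vec m (\<lambda>i. complex_of_real (sqrt (1 - \<alpha> i)) *\<^sub>C A (vec_index F i))"
  by (rule eq_vecI)
     (auto simp: tensor_op_def D_mat_def mat_diag_def if_distrib[of "\<lambda>c. c *\<^sub>C _"] cong: if_cong)

lemma tensor_op_D_tilde_mat:
  assumes "m \<le> n"
  shows "tensor_op A (D_tilde_mat n m \<alpha>) F = Matrix.vec n
    (\<lambda>i. if i < m then complex_of_real (sqrt (1 - \<alpha> i)) *\<^sub>C A (vec_index F i) else 0)"
  by (rule eq_vecI)
     (use assms in \<open>auto simp: tensor_op_def dim_D_tilde_mat D_tilde_mat_index
       if_distrib[of "\<lambda>c. c *\<^sub>C _"] cong: if_cong\<close>)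

section \<open>Orthonormal chains\<close>

definition orthonormal_seq :: "(nat \<Rightarrow> 'a::complex_inner) \<Rightarrow> bool" where
  "orthonormal_seq u \<longleftrightarrow> (\<forall>k l. cinner (u k) (u l) = (if k = l then 1 else 0))"

text \<open>Fourier coefficients along u are stored as Taylor coefficients, so that moving along the
  chain u turns into M_z and its adjoint. \<open>synthesis_op\<close> is the adjoint map
  back.\<close>

definition analysis_op :: "(nat \<Rightarrow> 'a::complex_inner) \<Rightarrow> 'a \<Rightarrow> hardy" where
  "analysis_op u x = hardy_of (\<lambda>k. cinner x (u k))"

definition synthesis_op :: "(nat \<Rightarrow> 'a::complex_inner) \<Rightarrow> hardy \<Rightarrow> 'a" where
  "synthesis_op u f = (\<Sum>k. hcoeff f k *\<^sub>C u k)"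

lemma cinner_orthonormal_sums:
  assumes u: "orthonormal_seq u" and I: "finite I"
  shows "cinner (\<Sum>k\<in>I. a k *\<^sub>C u k) (\<Sum>k\<in>I. b k *\<^sub>C u k) = (\<Sum>k\<in>I. a k * cnj (b k))"
proof -
  have "cinner (a k *\<^sub>C u k) (\<Sum>l\<in>I. b l *\<^sub>C u l) = a k * cnj (b k)" if "k \<in> I" for k
  proof -
    have "cinner (a k *\<^sub>C u k) (\<Sum>l\<in>I. b l *\<^sub>C u l) =
        (\<Sum>l\<in>I. if l = k then a k * cnj (b k) else 0)"
      unfolding cinner_sum_right
      using u by (intro sum.cong refl) (auto simp: orthonormal_seq_def cinner_simps)
    with that I show ?thesis
      by simp
  qed
  then show ?thesis
    by (simp add: cinner_sum_left)
qed

text \<open>Bessel's inequality: subtracting a partial sum of the expansion from x lowers the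
  squared norm by exactly the sum of the squared coefficients.\<close>

lemma summable_cinner_orthonormal:
  assumes u: "orthonormal_seq u"
  shows "summable (\<lambda>k. (cmod (cinner x (u k)))\<^sup>2)"
proof (rule summableI_nonneg_bounded)
  fix n
  let ?c = "\<lambda>k. cinner x (u k)"
  let ?p = "\<Sum>k<n. ?c k *\<^sub>C u k"
  let ?s = "\<Sum>k<n. (cmod (?c k))\<^sup>2"
  have s: "(\<Sum>k<n. ?c k * cnj (?c k)) = complex_of_real ?s"
    by (simp add: complex_norm_square del: of_real_power)
  have "cinner ?p ?p = complex_of_real ?s"
    using cinner_orthonormal_sums[OF u, of "{..<n}" ?c ?c] s by simp
  moreover have xp: "cinner x ?p = complex_of_real ?s"
    unfolding s[symmetric] cinner_sum_right
    by (intro sum.cong refl) (simp add: cinner_scaleC_right mult.commute)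
  moreover have "cinner ?p x = complex_of_real ?s"
    using cinner_commute[of ?p x] xp by simp
  ultimately have "cinner (x - ?p) (x - ?p) = complex_of_real ((norm x)\<^sup>2 - ?s)"
    by (simp add: cinner_simps cinner_self[of x])
  then have "(norm x)\<^sup>2 - ?s = (norm (x - ?p))\<^sup>2"
    unfolding cinner_self by (metis of_real_eq_iff)
  then show "?s \<le> (norm x)\<^sup>2"
    by (metis diff_ge_0_iff_ge zero_le_power2)
qed simp

lemma hcoeff_analysis_op: "orthonormal_seq u \<Longrightarrow> hcoeff (analysis_op u x) k = cinner x (u k)"
  unfolding analysis_op_def by (rule hcoeff_hardy_of[OF summable_cinner_orthonormal])

lemma analysis_op_add:
  "orthonormal_seq u \<Longrightarrow> analysis_op u (x + y) = analysis_op u x + analysis_op u y"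
  by (rule hcoeff_eqI) (simp add: hcoeff_analysis_op hcoeff_add cinner_add_left)

lemma analysis_op_scaleC:
  "orthonormal_seq u \<Longrightarrow> analysis_op u (c *\<^sub>C x) = c *\<^sub>C analysis_op u x"
  by (rule hcoeff_eqI) (simp add: hcoeff_analysis_op hcoeff_scaleC cinner_scaleC_left)

lemma analysis_op_sum:
  assumes "orthonormal_seq u"
  shows "analysis_op u (\<Sum>i\<in>I. x i) = (\<Sum>i\<in>I. analysis_op u (x i))"
  by (rule hcoeff_eqI) (simp add: hcoeff_analysis_op assms hcoeff_sum cinner_sum_left)

text \<open>By Pythagoras a block of the vector series has as squared norm the same block of squared
  coefficients; completeness of the space does the rest.\<close>

lemma summable_synthesis:
  fixes u :: "nat \<Rightarrow> 'a::chilbert_space"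
  assumes u: "orthonormal_seq u"
  shows "summable (\<lambda>k. hcoeff f k *\<^sub>C u k)"
  unfolding summable_Cauchy
proof (intro allI impI)
  fix \<epsilon> :: real
  assume \<epsilon>: "0 < \<epsilon>"
  then obtain N where N: "\<And>m n. N \<le> m \<Longrightarrow> norm (\<Sum>k=m..<n. (cmod (hcoeff f k))\<^sup>2) < \<epsilon>\<^sup>2"
    using hardy_summable[of f] unfolding summable_Cauchy by (meson zero_less_power)
  show "\<exists>N. \<forall>m\<ge>N. \<forall>n. norm (\<Sum>k=m..<n. hcoeff f k *\<^sub>C u k) < \<epsilon>"
  proof (intro exI allI impI)
    fix m n
    assume "N \<le> m"
    let ?s = "\<Sum>k=m..<n. (cmod (hcoeff f k))\<^sup>2"
    have "complex_of_real ((norm (\<Sum>k=m..<n. hcoeff f k *\<^sub>C u k))\<^sup>2) = complex_of_real ?s"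
      using cinner_orthonormal_sums[OF u, of "{m..<n}" "hcoeff f" "hcoeff f"]
      by (simp add: cinner_self complex_norm_square del: of_real_power)
    then have "(norm (\<Sum>k=m..<n. hcoeff f k *\<^sub>C u k))\<^sup>2 = ?s"
      by (metis of_real_eq_iff)
    also have "\<dots> < \<epsilon>\<^sup>2"
      using N[OF \<open>N \<le> m\<close>, of n] by simp
    finally show "norm (\<Sum>k=m..<n. hcoeff f k *\<^sub>C u k) < \<epsilon>"
      using \<epsilon> by (simp add: power2_less_imp_less)
  qed
qed

lemma cinner_synthesis_op:
  fixes u :: "nat \<Rightarrow> 'a::chilbert_space"
  assumes u: "orthonormal_seq u"
  shows "cinner (synthesis_op u f) y = cinner f (analysis_op u y)"
proof -
  have "cinner (synthesis_op u f) y = (\<Sum>k. cinner (hcoeff f k *\<^sub>C u k) y)"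
    unfolding synthesis_op_def
    by (rule bounded_linear.suminf[OF bounded_linear_cinner_left summable_synthesis[OF u]])
  also have "\<dots> = cinner f (analysis_op u y)"
    unfolding cinner_hardy_def
    by (simp add: hcoeff_analysis_op[OF u] cinner_scaleC_left cinner_commute[of "u _" y])
  finally show ?thesis .
qed

definition orthonormal_chains :: "nat \<Rightarrow> (nat \<Rightarrow> nat \<Rightarrow> 'a::complex_inner) \<Rightarrow> bool" where
  "orthonormal_chains J w \<longleftrightarrow>
     (\<forall>i<J. \<forall>j<J. \<forall>k l. cinner (w i k) (w j l) = (if i = j \<and> k = l then 1 else 0))"

definition chain_complement :: "nat \<Rightarrow> (nat \<Rightarrow> nat \<Rightarrow> 'a::complex_inner) \<Rightarrow> 'a set" where
  "chain_complement J w = {x. \<forall>j<J. \<forall>k. cinner x (w j k) = 0}"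

text \<open>The orthogonal projection onto \<open>chain_complement J w\<close>, obtained by removing
  the Fourier expansion along all chains.\<close>

definition chain_proj :: "nat \<Rightarrow> (nat \<Rightarrow> nat \<Rightarrow> 'a::complex_inner) \<Rightarrow> 'a \<Rightarrow> 'a" where
  "chain_proj J w x = x - (\<Sum>j<J. synthesis_op (w j) (analysis_op (w j) x))"

lemma orthonormal_chains_seq: "orthonormal_chains J w \<Longrightarrow> j < J \<Longrightarrow> orthonormal_seq (w j)"
  by (simp add: orthonormal_chains_def orthonormal_seq_def)

lemma closed_csubspace_chain_complement: "closed_csubspace (chain_complement J w)"
proof -
  have eq: "chain_complement J w = (\<Inter>j\<in>{..<J}. \<Inter>k. {x. cinner x (w j k) = 0})"
    by (auto simp: chain_complement_def)
  have "closed (chain_complement J w)"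
    unfolding eq
    by (intro closed_INT ballI closed_Collect_eq linear_continuous_on bounded_linear_cinner_left
        continuous_on_const)
  moreover have "complex_vector.subspace (chain_complement J w)"
    by (simp add: complex_vector.subspace_def chain_complement_def cinner_simps)
  ultimately show ?thesis
    by (simp add: closed_csubspace_def)
qed

context
  fixes w :: "nat \<Rightarrow> nat \<Rightarrow> 'a::chilbert_space" and J :: nat
  assumes w: "orthonormal_chains J w"
begin

lemma analysis_synthesis:
  assumes "i < J" "j < J"
  shows "analysis_op (w i) (synthesis_op (w j) f) = (if i = j then f else 0)"
proof (rule hcoeff_eqI)
  fix l
  have "hcoeff (analysis_op (w i) (synthesis_op (w j) f)) l = (\<Sum>k. hcoeff f k * cinner (w j k) (w i l))"
    using assms orthonormal_chains_seq[OF w]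
    by (simp add: hcoeff_analysis_op cinner_synthesis_op cinner_hardy_def cinner_commute[of "w j _"])
  also have "\<dots> = (\<Sum>k\<in>{l}. hcoeff f k * cinner (w j k) (w i l))"
    using w assms by (intro suminf_finite) (auto simp: orthonormal_chains_def)
  also have "\<dots> = hcoeff (if i = j then f else 0) l"
    using w assms by (auto simp: orthonormal_chains_def hcoeff_zero)
  finally show "hcoeff (analysis_op (w i) (synthesis_op (w j) f)) l = hcoeff (if i = j then f else 0) l" .
qed

lemma mem_chain_complement_iff: "x \<in> chain_complement J w \<longleftrightarrow> (\<forall>j<J. analysis_op (w j) x = 0)"
proof -
  have "analysis_op (w j) x = 0 \<longleftrightarrow> (\<forall>k. cinner x (w j k) = 0)" if "j < J" for j
    using hcoeff_analysis_op[OF orthonormal_chains_seq[OF w that]]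
    by (metis hcoeff_eqI hcoeff_zero)
  then show ?thesis
    by (simp add: chain_complement_def)
qed

lemma analysis_op_chain_sum:
  assumes h: "h \<in> chain_complement J w" and j: "j < J"
  shows "analysis_op (w j) (h + (\<Sum>i<J. synthesis_op (w i) (f i))) = f j"
proof -
  have "analysis_op (w j) (h + (\<Sum>i<J. synthesis_op (w i) (f i))) =
      (\<Sum>i<J. if j = i then f i else 0)"
    using h j orthonormal_chains_seq[OF w j]
    by (simp add: analysis_op_add analysis_op_sum analysis_synthesis mem_chain_complement_iff)
  then show ?thesis
    using j by simp
qed

lemma chain_proj_chain_sum:
  assumes h: "h \<in> chain_complement J w"
  shows "chain_proj J w (h + (\<Sum>i<J. synthesis_op (w i) (f i))) = h"
  by (simp add: chain_proj_def analysis_op_chain_sum[OF h])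

lemma chain_proj_mem: "chain_proj J w x \<in> chain_complement J w"
  unfolding mem_chain_complement_iff
proof (intro allI impI)
  fix j
  assume j: "j < J"
  \<comment> \<open>The explicit 0 is what remains for the projection once the common summand is
    cancelled.\<close>
  have "0 + analysis_op (w j) x =
      analysis_op (w j) (chain_proj J w x) + (\<Sum>i<J. analysis_op (w j) (synthesis_op (w i) (analysis_op (w i) x)))"
    using orthonormal_chains_seq[OF w j]
    by (simp add: chain_proj_def flip: analysis_op_add analysis_op_sum)
  also have "(\<Sum>i<J. analysis_op (w j) (synthesis_op (w i) (analysis_op (w i) x))) = analysis_op (w j) x"
    using j by (simp add: analysis_synthesis)
  finally show "analysis_op (w j) (chain_proj J w x) = 0"
    by simp
qed

lemma cinner_chain_proj:
  assumes "h \<in> chain_complement J w"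
  shows "cinner (chain_proj J w x) h = cinner x h"
  using assms orthonormal_chains_seq[OF w]
  by (simp add: chain_proj_def cinner_diff_left cinner_sum_left cinner_synthesis_op
      mem_chain_complement_iff)

text \<open>Linearity of the projection and its commutation with reducing operators are read off
  from this characterisation, without touching the series behind
  \<open>synthesis_op\<close>.\<close>

lemma chain_proj_unique:
  assumes y: "y \<in> chain_complement J w"
    and eq: "\<And>h. h \<in> chain_complement J w \<Longrightarrow> cinner y h = cinner x h"
  shows "chain_proj J w x = y"
proof -
  have "chain_proj J w x - y \<in> chain_complement J w"
    using closed_csubspace_chain_complement[of J w] chain_proj_mem[of x] y
    by (simp add: closed_csubspace_def complex_vector.subspace_diff)
  then have "cinner (chain_proj J w x - y) (chain_proj J w x - y) = 0"
    by (simp add: cinner_diff_left[of _ y] cinner_chain_proj eq)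
  then show ?thesis
    by (simp add: cinner_self_eq_0_iff)
qed

lemma chain_proj_add: "chain_proj J w (x + y) = chain_proj J w x + chain_proj J w y"
  using closed_csubspace_chain_complement[of J w] chain_proj_mem
  by (intro chain_proj_unique)
     (simp_all add: closed_csubspace_def complex_vector.subspace_add cinner_add_left cinner_chain_proj)

lemma chain_proj_scaleC: "chain_proj J w (c *\<^sub>C x) = c *\<^sub>C chain_proj J w x"
  using closed_csubspace_chain_complement[of J w] chain_proj_mem
  by (intro chain_proj_unique)
     (simp_all add: closed_csubspace_def complex_vector.subspace_scale cinner_scaleC_left cinner_chain_proj)

text \<open>Parseval's identity for the chains together with their complement; it is what makes the
  coordinate map below preserve inner products.\<close>

lemma cinner_chain_decomp:
  "cinner x y = (\<Sum>j<J. cinner (analysis_op (w j) x) (analysis_op (w j) y)) +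
     cinner (chain_proj J w x) (chain_proj J w y)"
proof -
  have "cinner x y = cinner (chain_proj J w x) y +
      cinner (\<Sum>j<J. synthesis_op (w j) (analysis_op (w j) x)) y"
    by (simp add: chain_proj_def flip: cinner_add_left)
  also have "cinner (chain_proj J w x) y = cinner (chain_proj J w x) (chain_proj J w y)"
    using cinner_chain_proj[OF chain_proj_mem, of y x] cinner_commute by metis
  finally show ?thesis
    using orthonormal_chains_seq[OF w] by (simp add: cinner_sum_left cinner_synthesis_op)
qed

text \<open>Paired with h in the complement, T moves over to S h, which stays in the complement, and
  there x and its projection have the same inner products.\<close>

lemma chain_proj_commute:
  assumes T: "\<And>x. x \<in> chain_complement J w \<Longrightarrow> T x \<in> chain_complement J w"
    and S: "\<And>x. x \<in> chain_complement J w \<Longrightarrow> S x \<in> chain_complement J w"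
    and TS: "\<And>x y. cinner (T x) y = cinner x (S y)"
  shows "chain_proj J w (T x) = T (chain_proj J w x)"
  by (rule chain_proj_unique) (simp_all add: T S TS chain_proj_mem cinner_chain_proj)

end

section \<open>From the self-commutator to the model\<close>

lemma cinner_adj_funpow:
  fixes T :: "'a::chilbert_space \<Rightarrow> 'a"
  assumes "bounded_clinear T"
  shows "cinner ((adj T ^^ k) x) y = cinner x ((T ^^ k) y)"
  by (induction k arbitrary: y) (simp_all add: cinner_adj' assms funpow_swap1[of T])

lemma self_comm_orthonormal_coeff:
  assumes "orthonormal_family n e"
    and "self_comm T = (\<lambda>h. \<Sum>j<n. complex_of_real (\<alpha> j) *\<^sub>C rank_one (e j) (e j) h)" and "l < n"
  shows "cinner (self_comm T h) (e l) = complex_of_real (\<alpha> l) * cinner h (e l)"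
proof -
  have "cinner (self_comm T h) (e l) = (\<Sum>j<n. if j = l then complex_of_real (\<alpha> l) * cinner h (e l) else 0)"
    unfolding assms(2) cinner_sum_left using assms(1,3)
    by (intro sum.cong refl) (auto simp: orthonormal_family_def rank_one_def cinner_scaleC_left)
  then show ?thesis
    using assms(3) by simp
qed

lemma sum_lessThan_add:
  fixes f :: "nat \<Rightarrow> 'b::comm_monoid_add"
  shows "(\<Sum>i<n + m. f i) = (\<Sum>i<n. f i) + (\<Sum>i<m. f (n + i))"
  by (induction m) (simp_all add: add.assoc)

text \<open>Backward chains exist only where alpha i < 1. The assumption on m places these indices
  first, as the block shape of \<open>D_tilde_mat\<close> demands.\<close>

context
  fixes T :: "'a::chilbert_space \<Rightarrow> 'a" and n m :: nat and e :: "nat \<Rightarrow> 'a" and \<alpha> :: "nat \<Rightarrow> real"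
  assumes contr: "contraction T" and e: "orthonormal_family n e"
    and \<alpha>: "\<alpha> ` {..<n} \<subseteq> {0<..1}"
    and Te: "\<forall>i<n. adj T (T (e i)) = e i"
    and sc: "self_comm T = (\<lambda>h. \<Sum>j<n. complex_of_real (\<alpha> j) *\<^sub>C rank_one (e j) (e j) h)"
    and m: "m \<le> n" "\<forall>i<n. \<alpha> i < 1 \<longleftrightarrow> i < m"
begin

private abbreviation c where "c i \<equiv> complex_of_real (sqrt (1 - \<alpha> i))"

private definition p where "p i k = (T ^^ k) (e i)"
text \<open>The exponent is \<open>Suc k\<close> because q i 0 already lies one step of
  \<open>adj T\<close> beyond e i = p i 0. The scalar is chosen so that T and \<open>adj T\<close>
  both act along the chain with the same factor c i.\<close>

private definition q where "q i k = inverse (c i ^ Suc k) *\<^sub>C (adj T ^^ Suc k) (e i)"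
private definition w where "w j = (if j < n then p j else q (j - n))"

private lemma T: "bounded_clinear T"
  by (rule bounded_clinear_contraction[OF contr])

private lemma Tadj: "bounded_clinear (adj T)"
  by (rule bounded_clinear_adj[OF T])

private lemmas T_linear = linear_0[OF bounded_linear.linear[OF bounded_clinear_bounded_linear[OF T]]]
  linear_add[OF bounded_linear.linear[OF bounded_clinear_bounded_linear[OF T]]]
  bounded_clinear_scaleC[OF T]

private lemmas adj_linear = linear_0[OF bounded_linear.linear[OF bounded_clinear_bounded_linear[OF Tadj]]]
  linear_add[OF bounded_linear.linear[OF bounded_clinear_bounded_linear[OF Tadj]]]
  bounded_clinear_scaleC[OF Tadj]

private lemma c_squared: "i < n \<Longrightarrow> c i * c i = complex_of_real (1 - \<alpha> i)"
  using \<alpha> by (auto simp flip: of_real_mult)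

private lemma c_nonzero:
  assumes "i < m"
  shows "c i \<noteq> 0"
proof -
  have "\<alpha> i < 1"
    using m assms by simp
  then show ?thesis
    by simp
qed

private lemma inverse_c: "i < m \<Longrightarrow> inverse (c i) * complex_of_real (1 - \<alpha> i) = c i"
  using c_squared[of i, symmetric] c_nonzero[of i] m by simp

private lemma c_zero: "i < n \<Longrightarrow> \<not> i < m \<Longrightarrow> \<alpha> i = 1"
  using m \<alpha> by force

section \<open>The forward orbit of e i\<close>

private lemma self_comm_eq_0: "(\<And>l. l < n \<Longrightarrow> cinner h (e l) = 0) \<Longrightarrow> adj T (T h) = T (adj T h)"
  using fun_cong[OF sc, of h] by (simp add: self_comm_def rank_one_def)

text \<open>The coefficient of the self-commutator of h along e l is alpha l times that of h, and
  alpha l is positive.\<close>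

private lemma orthogonal_of_commute:
  assumes "adj T (T h) = T (adj T h)" "l < n"
  shows "cinner h (e l) = 0"
proof -
  have "complex_of_real (\<alpha> l) * cinner h (e l) = 0"
    using self_comm_orthonormal_coeff[OF e sc assms(2), of h] assms(1) by (simp add: self_comm_def)
  moreover have "\<alpha> l \<noteq> 0"
    using \<alpha> assms(2) by force
  ultimately show ?thesis
    by simp
qed

text \<open>Since the inner product of T*T y with y is the squared norm of y, the squared distance
  of T*T y from y is |T*T y|^2 - |y|^2, which is at most 0 for a contraction.\<close>

private lemma adj_T_isometric:
  assumes "norm (T y) = norm y"
  shows "adj T (T y) = y"
proof -
  have "inner (adj T (T y)) y = (norm y)\<^sup>2"
    using assms by (simp add: inner_eq_Re_cinner cinner_adj'[OF T] cinner_self)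
  then have "(norm (adj T (T y) - y))\<^sup>2 = (norm (adj T (T y)))\<^sup>2 - (norm y)\<^sup>2"
    by (simp add: power2_norm_eq_inner inner_diff_left inner_diff_right inner_commute)
  moreover have "(norm (adj T (T y)))\<^sup>2 \<le> (norm y)\<^sup>2"
    using norm_adj_le[OF contr, of "T y"] assms by (intro power_mono) simp_all
  ultimately have "(norm (adj T (T y) - y))\<^sup>2 \<le> 0"
    by simp
  then show ?thesis
    by simp
qed

private lemma norm_adj_T_le: "norm (adj T h) \<le> norm (T h)"
proof -
  have "hyponormal T"
    using n_finite_decomp_iff[of n T e \<alpha>] contr e \<alpha> Te sc unfolding n_finite_def by blast
  then have "0 \<le> Re (cinner (self_comm T h) h)"
    by (simp add: hyponormal_def positive_op_def)
  then have "(norm (adj T h))\<^sup>2 \<le> (norm (T h))\<^sup>2"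
    by (simp add: self_comm_def cinner_diff_left cinner_adj'[OF T] cinner_adj[OF T] cinner_self)
  then show ?thesis
    by (simp add: power2_le_iff_abs_le)
qed

text \<open>Hyponormality carries the isometric behaviour from h = p i k to T h: |T h| = |h| = |T*T
  h| <= |T T h| <= |T h|, so equality holds throughout.\<close>

private lemma adj_T_p: "i < n \<Longrightarrow> adj T (T (p i k)) = p i k"
proof (induction k)
  case 0
  then show ?case
    using Te by (simp add: p_def)
next
  case (Suc k)
  have p_Suc: "p i (Suc k) = T (p i k)"
    by (simp add: p_def)
  have "(norm (T (p i k)))\<^sup>2 = inner (adj T (T (p i k))) (p i k)"
    by (simp add: inner_eq_Re_cinner cinner_adj'[OF T] cinner_self)
  then have "norm (T (p i k)) = norm (p i k)"
    using Suc by (simp add: power2_norm_eq_inner[symmetric] power2_eq_iff_nonneg)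
  then have "norm (T (p i k)) \<le> norm (T (T (p i k)))"
    using norm_adj_T_le[of "T (p i k)"] Suc by simp
  then show ?case
    unfolding p_Suc using norm_contraction[OF contr, of "T (p i k)"] by (intro adj_T_isometric) simp
qed

private lemma T_p: "T (p i k) = p i (Suc k)"
  by (simp add: p_def)

private lemma adj_p_Suc: "i < n \<Longrightarrow> adj T (p i (Suc k)) = p i k"
  using adj_T_p[of i k] by (simp add: T_p)

text \<open>T*T and TT* both fix p i (k+1), so the self-commutator vanishes there. The index must be
  positive, since TT* multiplies p i 0 by 1 - alpha i.\<close>

private lemma cinner_p_Suc_e:
  assumes "i < n" "l < n"
  shows "cinner (p i (Suc k)) (e l) = 0"
  by (rule orthogonal_of_commute)
     (simp_all add: assms adj_T_p adj_p_Suc T_p)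

text \<open>Moving the powers of the adjoint to the other side leaves the conjugate of a product of
  p l (k+1) with e i.\<close>

private lemma cinner_adj_Suc_e:
  assumes "i < n" "l < n"
  shows "cinner ((adj T ^^ Suc k) (e i)) (e l) = 0"
  using cinner_p_Suc_e[OF assms(2,1), of k] cinner_commute[of "e i" "p l (Suc k)"]
  by (simp add: cinner_adj_funpow[OF T] p_def del: funpow.simps)

section \<open>The backward orbit of e i\<close>

private lemma T_adj_e:
  assumes "i < n"
  shows "T (adj T (e i)) = complex_of_real (1 - \<alpha> i) *\<^sub>C e i"
proof -
  have "adj T (T (e i)) - T (adj T (e i)) = complex_of_real (\<alpha> i) *\<^sub>C e i"
    using fun_cong[OF sc, of "e i"] rank_one_sum_orthonormal[OF e assms, of "\<lambda>j. complex_of_real (\<alpha> j)"]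
    by (simp add: self_comm_def)
  then show ?thesis
    using Te assms by (simp add: complex_vector.scale_left_diff_distrib algebra_simps)
qed

text \<open>At a positive power of \<open>adj T\<close> applied to e i, T and its adjoint commute,
  since the vector is orthogonal to all e l. The factor 1 - alpha i found at e i is thus handed down
  the whole orbit.\<close>

private lemma T_adj_Suc:
  assumes "i < n"
  shows "T ((adj T ^^ Suc k) (e i)) = complex_of_real (1 - \<alpha> i) *\<^sub>C (adj T ^^ k) (e i)"
proof (induction k)
  case 0
  show ?case
    using T_adj_e[OF assms] by simp
next
  case (Suc k)
  have "T ((adj T ^^ Suc (Suc k)) (e i)) = T (adj T ((adj T ^^ Suc k) (e i)))"
    by simp
  also have "\<dots> = adj T (T ((adj T ^^ Suc k) (e i)))"
    by (rule self_comm_eq_0[symmetric]) (rule cinner_adj_Suc_e[OF assms])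
  also have "\<dots> = complex_of_real (1 - \<alpha> i) *\<^sub>C (adj T ^^ Suc k) (e i)"
    unfolding Suc by (simp add: adj_linear)
  finally show ?case .
qed

private lemma adj_q: "i < m \<Longrightarrow> adj T (q i k) = c i *\<^sub>C q i (Suc k)"
  using c_nonzero[of i] by (simp add: q_def adj_linear scaleC_scaleC)

private lemma T_q_0: "i < m \<Longrightarrow> T (q i 0) = c i *\<^sub>C p i 0"
  using c_nonzero[of i] m T_adj_Suc[of i 0]
  by (simp add: q_def p_def T_linear scaleC_scaleC inverse_c del: of_real_diff)

private lemma T_q_Suc: "i < m \<Longrightarrow> T (q i (Suc k)) = c i *\<^sub>C q i k"
  using c_nonzero[of i] m T_adj_Suc[of i "Suc k"]
  by (simp add: q_def T_linear scaleC_scaleC mult.assoc mult.commute[of "inverse (c i ^ k)"] inverse_c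
      del: funpow.simps of_real_diff)

private lemma adj_p_0: "i < n \<Longrightarrow> adj T (p i 0) = (if i < m then c i *\<^sub>C q i 0 else 0)"
proof -
  assume i: "i < n"
  show ?thesis
  proof (cases "i < m")
    case True
    then show ?thesis
      using c_nonzero[of i] by (simp add: p_def q_def scaleC_scaleC)
  next
    case False
    \<comment> \<open>Here alpha i = 1, so \<open>adj T\<close> annihilates e i and the forward
      chain has no backward continuation.\<close>
    then have "T (adj T (e i)) = 0"
      using T_adj_e[OF i] c_zero[OF i] by simp
    then have "cinner (adj T (e i)) (adj T (e i)) = 0"
      by (simp add: cinner_adj'[OF T])
    with False show ?thesis
      by (simp add: p_def cinner_self_eq_0_iff)
  qed
qed

section \<open>Orthonormality of all chains\<close>

private lemma cinner_p_p:
  "i < n \<Longrightarrow> j < n \<Longrightarrow> cinner (p i k) (p j l) = (if i = j \<and> k = l then 1 else 0)"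
proof (induction l arbitrary: k)
  case 0
  then show ?case
    using e cinner_p_Suc_e[of i j]
    by (cases k) (auto simp: p_def orthonormal_family_def simp del: funpow.simps(2))
next
  case (Suc l)
  show ?case
  proof (cases k)
    case 0
    then show ?thesis
      using Suc.prems cinner_p_Suc_e[of j i l] cinner_commute[of "p i 0" "p j (Suc l)"]
      by (simp add: p_def del: funpow.simps(2))
  next
    case (Suc k')
    \<comment> \<open>T is isometric along the chains, so both indices can be lowered
      together.\<close>
    have "cinner (p i (Suc k')) (p j (Suc l)) = cinner (p i k') (p j l)"
      using adj_T_p[OF Suc.prems(1), of k'] by (simp add: cinner_adj'[OF T, symmetric] flip: T_p)
    then show ?thesis
      using Suc Suc.IH Suc.prems by simp
  qed
qed

text \<open>Up to a scalar this is the product of p i 0 with p j (k+1+l), and that index is never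
  0.\<close>

private lemma cinner_q_p:
  assumes "i < m" "j < n"
  shows "cinner (q i k) (p j l) = 0"
proof -
  have "cinner ((adj T ^^ Suc k) (e i)) (p j l) = cinner (p i 0) (p j (Suc k + l))"
    unfolding cinner_adj_funpow[OF T] p_def funpow_add comp_apply by simp
  then show ?thesis
    using assms m by (simp add: q_def cinner_scaleC_left cinner_p_p del: funpow.simps(2))
qed

text \<open>c j q j l is the image under \<open>adj T\<close> of its predecessor, which is p j 0
  when l = 0. Moving the adjoint over lowers the index k as well; at the ends p meets q or p, and c
  j cancels.\<close>

private lemma cinner_q_q:
  "i < m \<Longrightarrow> j < m \<Longrightarrow> cinner (q i k) (q j l) = (if i = j \<and> k = l then 1 else 0)"
proof (induction l arbitrary: k)
  case 0
  have "c j * cinner (q i k) (q j 0) = cinner (q i k) (adj T (p j 0))"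
    using 0 m by (simp add: adj_p_0 cinner_scaleC_right)
  also have "\<dots> = cinner (T (q i k)) (p j 0)"
    by (simp add: cinner_adj[OF T])
  also have "\<dots> = c j * (if i = j \<and> k = 0 then 1 else 0)"
    using 0 m by (cases k) (auto simp: T_q_0 T_q_Suc cinner_scaleC_left cinner_p_p cinner_q_p)
  finally show ?case
    using c_nonzero[OF 0(2)] by simp
next
  case (Suc l)
  have "c j * cinner (q i k) (q j (Suc l)) = cinner (q i k) (adj T (q j l))"
    using Suc.prems by (simp add: adj_q cinner_scaleC_right)
  also have "\<dots> = cinner (T (q i k)) (q j l)"
    by (simp add: cinner_adj[OF T])
  also have "\<dots> = c j * (if i = j \<and> k = Suc l then 1 else 0)"
  proof (cases k)
    case 0
    have "cinner (p i 0) (q j l) = 0"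
      using cinner_q_p[of j i l 0] Suc.prems m cinner_commute[of "p i 0" "q j l"] by simp
    then show ?thesis
      using 0 Suc.prems by (simp add: T_q_0 cinner_scaleC_left)
  next
    case (Suc k')
    then show ?thesis
      using Suc.IH Suc.prems by (auto simp: T_q_Suc cinner_scaleC_left)
  qed
  finally show ?case
    using c_nonzero[OF Suc.prems(2)] by simp
qed

private lemma w_simps: "i < n \<Longrightarrow> w i = p i" "w (n + i) = q i"
  by (auto simp: w_def fun_eq_iff)

private lemma chain_cases:
  assumes "j < n + m"
  obtains (p) "j < n" | (q) i where "j = n + i" "i < m"
  using assms by (metis add_less_cancel_left le_add_diff_inverse not_le)

private lemma chains: "orthonormal_chains (n + m) w"
  unfolding orthonormal_chains_def
proof (intro allI impI)
  fix i j k l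
  assume i: "i < n + m" and j: "j < n + m"
  have pq: "cinner (p i' k) (q j' l) = 0" if "i' < n" "j' < m" for i' j'
    using cinner_q_p[of j' i' l k] that cinner_commute[of "p i' k" "q j' l"] by simp
  show "cinner (w i k) (w j l) = (if i = j \<and> k = l then 1 else 0)"
    by (rule chain_cases[OF i]; rule chain_cases[OF j])
       (auto simp: w_simps cinner_p_p cinner_q_q cinner_q_p pq)
qed

section \<open>The complement of the chains as a reducing subspace\<close>

private abbreviation H0 where "H0 \<equiv> chain_complement (n + m) w"

private lemma mem_H0_iff:
  "h \<in> H0 \<longleftrightarrow> (\<forall>i<n. \<forall>k. cinner h (p i k) = 0) \<and> (\<forall>i<m. \<forall>k. cinner h (q i k) = 0)"
proof
  assume h: "h \<in> H0"
  show "(\<forall>i<n. \<forall>k. cinner h (p i k) = 0) \<and> (\<forall>i<m. \<forall>k. cinner h (q i k) = 0)"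
  proof (intro conjI allI impI)
    fix i k
    show "cinner h (p i k) = 0" if "i < n"
      using h that w_simps(1)[OF that] unfolding chain_complement_def
      by (metis (mono_tags, lifting) mem_Collect_eq trans_less_add1)
    show "cinner h (q i k) = 0" if "i < m"
      using h that w_simps(2)[of i] unfolding chain_complement_def
      by (metis (mono_tags, lifting) mem_Collect_eq add_less_cancel_left)
  qed
next
  assume R: "(\<forall>i<n. \<forall>k. cinner h (p i k) = 0) \<and> (\<forall>i<m. \<forall>k. cinner h (q i k) = 0)"
  have "cinner h (w j k) = 0" if "j < n + m" for j k
    by (rule chain_cases[OF that]) (use R in \<open>auto simp: w_simps\<close>)
  then show "h \<in> H0"
    by (simp add: chain_complement_def)
qed

text \<open>Invariance under T holds because \<open>adj T\<close> sends every chain vector to 0 or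
  to a multiple of a chain vector. Invariance under \<open>adj T\<close> below is the same with T
  acting on the chains.\<close>

private lemma T_H0: "h \<in> H0 \<Longrightarrow> T h \<in> H0"
  unfolding mem_H0_iff
proof (intro conjI allI impI)
  fix i k
  assume h: "(\<forall>i<n. \<forall>k. cinner h (p i k) = 0) \<and> (\<forall>i<m. \<forall>k. cinner h (q i k) = 0)"
  show "cinner (T h) (p i k) = 0" if "i < n"
    using h that m by (cases k) (auto simp: cinner_adj[OF T] adj_p_0 adj_p_Suc cinner_scaleC_right)
  show "cinner (T h) (q i k) = 0" if "i < m"
    using h that m by (auto simp: cinner_adj[OF T] adj_q cinner_scaleC_right)
qed

private lemma adj_H0: "h \<in> H0 \<Longrightarrow> adj T h \<in> H0"
  unfolding mem_H0_iff
proof (intro conjI allI impI)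
  fix i k
  assume h: "(\<forall>i<n. \<forall>k. cinner h (p i k) = 0) \<and> (\<forall>i<m. \<forall>k. cinner h (q i k) = 0)"
  show "cinner (adj T h) (p i k) = 0" if "i < n"
    using h that m by (auto simp: cinner_adj'[OF T] T_p)
  show "cinner (adj T h) (q i k) = 0" if "i < m"
    using h that m by (cases k) (auto simp: cinner_adj'[OF T] T_q_0 T_q_Suc cinner_scaleC_right)
qed

private lemma bounded_clinear_on_subset:
  assumes "bounded_clinear A" "A ` M \<subseteq> M"
  shows "bounded_clinear_on M A"
proof -
  interpret A: bounded_linear A
    by (rule bounded_clinear_bounded_linear[OF assms(1)])
  obtain K where "\<And>x. norm (A x) \<le> norm x * K"
    using A.bounded by blast
  then have "\<exists>K. \<forall>x\<in>M. norm (A x) \<le> K * norm x"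
    by (metis mult.commute)
  then show ?thesis
    unfolding bounded_clinear_on_def
    using assms(2) by (simp add: A.add bounded_clinear_scaleC[OF assms(1)])
qed

text \<open>Every e l = p l 0 is a chain vector, so the self-commutator vanishes on the complement
  and \<open>adj T\<close> serves as the adjoint of the restriction.\<close>

private lemma normal_contraction_on_H0: "normal_contraction_on H0 T"
  unfolding normal_contraction_on_def normal_on_def
proof (intro conjI exI ballI)
  show "bounded_clinear_on H0 T" "bounded_clinear_on H0 (adj T)"
    using T Tadj T_H0 adj_H0 by (auto intro!: bounded_clinear_on_subset)
  show "adj T (T x) = T (adj T x)" if "x \<in> H0" for x
  proof (rule self_comm_eq_0)
    fix l
    assume "l < n"
    then have "cinner x (p l 0) = 0"
      using that unfolding mem_H0_iff by blast
    then show "cinner x (e l) = 0"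
      by (simp add: p_def)
  qed
qed (simp_all add: cinner_adj[OF T] norm_contraction[OF contr])

section \<open>The unitary onto the model space\<close>

private definition U where
  "U x = (Matrix.vec n (\<lambda>i. analysis_op (p i) x), Matrix.vec m (\<lambda>i. analysis_op (q i) x),
     chain_proj (n + m) w x)"

private lemma seq_p: "i < n \<Longrightarrow> orthonormal_seq (p i)"
  using orthonormal_chains_seq[OF chains, of i] by (simp add: w_simps)

private lemma seq_q: "i < m \<Longrightarrow> orthonormal_seq (q i)"
  using orthonormal_chains_seq[OF chains, of "n + i"] by (simp add: w_simps)

private definition V where
  "V = (\<lambda>(F, G, h). h + (\<Sum>j<n + m. synthesis_op (w j)
     (if j < n then vec_index F j else vec_index G (j - n))))"

private lemma V_U: "V (U x) = x"
proof -
  have "(\<Sum>j<n + m. synthesis_op (w j) (if j < n then vec_index (Matrix.vec n (\<lambda>i. analysis_op (p i) x)) j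
      else vec_index (Matrix.vec m (\<lambda>i. analysis_op (q i) x)) (j - n))) =
      (\<Sum>j<n + m. synthesis_op (w j) (analysis_op (w j) x))"
    by (intro sum.cong refl) (auto simp: w_def)
  then show ?thesis
    by (simp add: U_def V_def chain_proj_def)
qed

private lemma U_V:
  assumes F: "F \<in> carrier_vec n" and G: "G \<in> carrier_vec m" and h: "h \<in> H0"
  shows "U (V (F, G, h)) = (F, G, h)"
proof -
  let ?f = "\<lambda>j. if j < n then vec_index F j else vec_index G (j - n)"
  let ?x = "h + (\<Sum>j<n + m. synthesis_op (w j) (?f j))"
  have x: "analysis_op (w j) ?x = ?f j" if "j < n + m" for j
    by (rule analysis_op_chain_sum[OF chains h that])
  have "Matrix.vec n (\<lambda>i. analysis_op (p i) ?x) = F"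
    by (rule eq_vecI) (use F x in \<open>auto simp flip: w_simps\<close>)
  moreover have "analysis_op (q i) ?x = vec_index G i" if "i < m" for i
    using x[of "n + i"] that by (simp add: w_simps)
  then have "Matrix.vec m (\<lambda>i. analysis_op (q i) ?x) = G"
    by (intro eq_vecI) (use G in auto)
  moreover have "chain_proj (n + m) w ?x = h"
    by (rule chain_proj_chain_sum[OF chains h])
  ultimately show ?thesis
    by (simp add: U_def V_def)
qed

private lemma unitary_U: "unitary_between U (subspace_ip UNIV) (X2_space n m H0)"
  unfolding unitary_between_def
proof (intro conjI ballI allI)
  show "bij_betw U (car (subspace_ip UNIV)) (car (X2_space n m H0))"
  proof (rule bij_betw_byWitness[where f' = V])
    show "\<forall>a\<in>car (subspace_ip UNIV). V (U a) = a"
      by (simp add: V_U)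
    show "\<forall>a\<in>car (X2_space n m H0). U (V a) = a"
      by (auto simp: X2_space_def dsum_def tensor_Cn_def subspace_ip_def U_V)
    show "U ` car (subspace_ip UNIV) \<subseteq> car (X2_space n m H0)"
      by (auto simp: X2_space_def dsum_def tensor_Cn_def subspace_ip_def U_def chain_proj_mem[OF chains])
  qed (simp add: subspace_ip_def)
  fix x y :: 'a and a :: complex
  show "U (vadd (subspace_ip UNIV) x y) = vadd (X2_space n m H0) (U x) (U y)"
    by (auto simp: X2_space_def dsum_def tensor_Cn_def subspace_ip_def U_def
        chain_proj_add[OF chains] analysis_op_add seq_p seq_q intro!: eq_vecI)
  show "U (vscale (subspace_ip UNIV) a x) = vscale (X2_space n m H0) a (U x)"
    by (auto simp: X2_space_def dsum_def tensor_Cn_def subspace_ip_def U_def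
        chain_proj_scaleC[OF chains] analysis_op_scaleC seq_p seq_q intro!: eq_vecI)
  show "vinner (X2_space n m H0) (U x) (U y) = vinner (subspace_ip UNIV) x y"
    using cinner_chain_decomp[OF chains, of x y]
    by (simp add: X2_space_def dsum_def tensor_Cn_def subspace_ip_def U_def sum_lessThan_add w_simps
        add.assoc)
qed

private lemma U_T: "U (T x) = X2 n m \<alpha> T (U x)"
proof -
  have "chain_proj (n + m) w (T x) = T (chain_proj (n + m) w x)"
    by (rule chain_proj_commute[OF chains T_H0 adj_H0 cinner_adj[OF T]])
  \<comment> \<open>The k-th coefficient of T x along p i is the product of x with
    \<open>adj T (p i k)\<close>. For k > 0 this is the shift; for k = 0 the adjoint leads into q i
    0, and this is the entry with P_C.\<close>
  moreover have "analysis_op (p i) (T x) = hardy_Mz (analysis_op (p i) x) +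
      (if i < m then c i *\<^sub>C hardy_PC (analysis_op (q i) x) else 0)" if "i < n" for i
  proof (rule hcoeff_eqI)
    fix k
    show "hcoeff (analysis_op (p i) (T x)) k = hcoeff (hardy_Mz (analysis_op (p i) x) +
      (if i < m then c i *\<^sub>C hardy_PC (analysis_op (q i) x) else 0)) k"
      using that
      by (cases k) (auto simp: hcoeff_analysis_op seq_p seq_q cinner_adj[OF T] adj_p_0 adj_p_Suc
          hcoeff_add hcoeff_Mz hcoeff_scaleC hardy_PC_eq hcoeff_const hcoeff_zero cinner_scaleC_right)
  qed
  moreover have "analysis_op (q i) (T x) = c i *\<^sub>C adj hardy_Mz (analysis_op (q i) x)" if "i < m" for i
    by (rule hcoeff_eqI) (simp add: that hcoeff_analysis_op seq_q cinner_adj[OF T] adj_q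
        hcoeff_scaleC hcoeff_adj_Mz cinner_scaleC_right)
  ultimately show ?thesis
    using m(1)
    by (auto simp: U_def X2_def tensor_op_one tensor_op_D_mat tensor_op_D_tilde_mat intro!: eq_vecI)
qed

lemma equiv_X2_of_decomp: "equiv_X2 n m \<alpha> T"
  unfolding equiv_X2_def unitarily_equivalent_def
  using closed_csubspace_chain_complement normal_contraction_on_H0 unitary_U U_T by blast

end

section \<open>From the model to the self-commutator\<close>

lemma cinner_PC_left: "cinner (hardy_PC f) g = hcoeff f 0 * cnj (hcoeff g 0)"
  using cinner_hardy_const[of g "hcoeff f 0"] cinner_commute[of "hardy_PC f" g]
  by (simp add: hardy_PC_eq)

lemma cinner_PC_right: "cinner f (hardy_PC g) = hcoeff f 0 * cnj (hcoeff g 0)"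
  by (simp add: hardy_PC_eq cinner_hardy_const)

lemma cinner_adj_Mz: "cinner (adj hardy_Mz f) g = cinner f (hardy_Mz g)"
  using cinner_Mz[of g f] cinner_commute[of f "hardy_Mz g"] cinner_commute[of "adj hardy_Mz f" g]
  by simp

section \<open>The model operator, its adjoint and their products\<close>

lemma car_subspace_ip: "car (subspace_ip M) = M"
  by (simp add: subspace_ip_def)

lemma car_X2_space: "car (X2_space n m H0) = carrier_vec n \<times> carrier_vec m \<times> H0"
  by (simp add: X2_space_def dsum_def tensor_Cn_def subspace_ip_def)

lemma vinner_X2_space:
  "vinner (X2_space n m H0) (F, G, h) (F', G', h') =
    (\<Sum>i<n. cinner (vec_index F i) (vec_index F' i)) +
    (\<Sum>i<m. cinner (vec_index G i) (vec_index G' i)) + cinner h h'"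
  by (simp add: X2_space_def dsum_def tensor_Cn_def subspace_ip_def add.assoc)

lemma X2_coordinates:
  assumes "m \<le> n"
  shows "X2 n m \<alpha> N (F, G, h) =
    (Matrix.vec n (\<lambda>i. hardy_Mz (vec_index F i) +
       (if i < m then complex_of_real (sqrt (1 - \<alpha> i)) *\<^sub>C hardy_PC (vec_index G i) else 0)),
     Matrix.vec m (\<lambda>i. complex_of_real (sqrt (1 - \<alpha> i)) *\<^sub>C adj hardy_Mz (vec_index G i)), N h)"
  using assms
  by (auto simp: X2_def tensor_op_one tensor_op_D_mat tensor_op_D_tilde_mat intro!: eq_vecI)

text \<open>The conjugate transpose of the block matrix of \<open>X2\<close>, with S in the role of
  the adjoint of N. The model space is a record rather than a type, so \<open>adj\<close> cannot be
  applied to it.\<close>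

definition X2_adj where
  "X2_adj n m \<alpha> S = (\<lambda>(F, G, h).
    (Matrix.vec n (\<lambda>i. adj hardy_Mz (vec_index F i)),
     Matrix.vec m (\<lambda>i. complex_of_real (sqrt (1 - \<alpha> i)) *\<^sub>C
       (hardy_PC (vec_index F i) + hardy_Mz (vec_index G i))), S h))"

lemma sum_lessThan_if:
  fixes f :: "nat \<Rightarrow> 'b::comm_monoid_add"
  assumes "m \<le> n"
  shows "(\<Sum>i<n. if i < m then f i else 0) = (\<Sum>i<m. f i)"
  using assms by (intro sum.mono_neutral_cong_right) auto

lemma vinner_X2_X2_adj:
  assumes "m \<le> n" "cinner (N h) h' = cinner h (S h')"
  shows "vinner (X2_space n m H0) (X2 n m \<alpha> N (F, G, h)) (F', G', h') =
    vinner (X2_space n m H0) (F, G, h) (X2_adj n m \<alpha> S (F', G', h'))"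
proof -
  let ?c = "\<lambda>i. complex_of_real (sqrt (1 - \<alpha> i))"
  have "(\<Sum>i<n. cinner (hardy_Mz (vec_index F i) +
        (if i < m then ?c i *\<^sub>C hardy_PC (vec_index G i) else 0)) (vec_index F' i)) =
      (\<Sum>i<n. cinner (vec_index F i) (adj hardy_Mz (vec_index F' i))) +
      (\<Sum>i<n. if i < m then cinner (vec_index G i) (?c i *\<^sub>C hardy_PC (vec_index F' i)) else 0)"
    unfolding sum.distrib[symmetric]
    by (intro sum.cong refl)
       (auto simp: cinner_simps cinner_Mz cinner_PC_left cinner_PC_right)
  moreover have "(\<Sum>i<m. cinner (?c i *\<^sub>C adj hardy_Mz (vec_index G i)) (vec_index G' i)) =
      (\<Sum>i<m. cinner (vec_index G i) (?c i *\<^sub>C hardy_Mz (vec_index G' i)))"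
    by (simp add: cinner_simps cinner_adj_Mz)
  ultimately show ?thesis
    using assms
    by (simp add: X2_coordinates X2_adj_def vinner_X2_space sum_lessThan_if cinner_simps sum.distrib
        distrib_left)
qed

lemma sqrt_defect_mult:
  assumes "\<alpha> ` {..<m} \<subseteq> {0<..1}" "i < m"
  shows "complex_of_real (sqrt (1 - \<alpha> i)) * (complex_of_real (sqrt (1 - \<alpha> i)) * z) =
    complex_of_real (1 - \<alpha> i) * z"
proof -
  have "complex_of_real (sqrt (1 - \<alpha> i)) * complex_of_real (sqrt (1 - \<alpha> i)) = complex_of_real (1 - \<alpha> i)"
    using assms by (auto simp flip: of_real_mult)
  then show ?thesis
    by (simp flip: mult.assoc)
qed

text \<open>The range of M_z is orthogonal to the constants, which kills the cross terms. In the
  second summand P_C + M_z M_z* = I adds up the two contributions with factor c^2 = 1 -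
  alpha.\<close>

lemma X2_adj_X2:
  assumes "m \<le> n" "\<alpha> ` {..<m} \<subseteq> {0<..1}" "F \<in> carrier_vec n" "G \<in> carrier_vec m"
  shows "X2_adj n m \<alpha> S (X2 n m \<alpha> N (F, G, h)) =
    (F, Matrix.vec m (\<lambda>i. complex_of_real (1 - \<alpha> i) *\<^sub>C vec_index G i), S (N h))"
proof -
  let ?c = "\<lambda>i. complex_of_real (sqrt (1 - \<alpha> i))"
  note c = sqrt_defect_mult[OF assms(2)]
  have "adj hardy_Mz (hardy_Mz f + (if i < m then ?c i *\<^sub>C hardy_PC g else 0)) = f" for f g i
    by (rule hcoeff_eqI)
       (auto simp: hcoeff_adj_Mz hcoeff_add hcoeff_Mz hcoeff_scaleC hardy_PC_eq hcoeff_const hcoeff_zero)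
  moreover have "?c i *\<^sub>C (hardy_PC (hardy_Mz f + ?c i *\<^sub>C hardy_PC g) +
      hardy_Mz (?c i *\<^sub>C adj hardy_Mz g)) = complex_of_real (1 - \<alpha> i) *\<^sub>C g" if "i < m" for f g i
    by (rule hcoeff_eqI)
       (auto simp: hcoeff_adj_Mz hcoeff_add hcoeff_Mz hcoeff_scaleC hardy_PC_eq hcoeff_const c[OF that]
         simp del: of_real_diff split: nat.split)
  ultimately show ?thesis
    using assms(1,3,4) by (auto simp: X2_coordinates X2_adj_def intro!: eq_vecI)
qed

text \<open>M_z M_z* = I - P_C misses the constants, and the coupling gives back (1 - alpha) P_C.
  The deficit is alpha P_C in a coupled coordinate and all of P_C in the others.\<close>

lemma X2_X2_adj:
  assumes "m \<le> n" "\<alpha> ` {..<m} \<subseteq> {0<..1}" "F \<in> carrier_vec n" "G \<in> carrier_vec m"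
  shows "X2 n m \<alpha> N (X2_adj n m \<alpha> S (F, G, h)) =
    (Matrix.vec n (\<lambda>i. vec_index F i -
       complex_of_real (if i < m then \<alpha> i else 1) *\<^sub>C hardy_PC (vec_index F i)),
     Matrix.vec m (\<lambda>i. complex_of_real (1 - \<alpha> i) *\<^sub>C vec_index G i), N (S h))"
proof -
  let ?c = "\<lambda>i. complex_of_real (sqrt (1 - \<alpha> i))"
  note c = sqrt_defect_mult[OF assms(2)]
  have "hardy_Mz (adj hardy_Mz f) + ?c i *\<^sub>C hardy_PC (?c i *\<^sub>C (hardy_PC f + hardy_Mz g)) =
      f - complex_of_real (\<alpha> i) *\<^sub>C hardy_PC f" if "i < m" for f g i
    by (rule hcoeff_eqI)
       (auto simp: Mz_adj_Mz hcoeff_diff hcoeff_add hcoeff_Mz hcoeff_scaleC hardy_PC_eq hcoeff_const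
         c[OF that] left_diff_distrib split: nat.split)
  moreover have "?c i *\<^sub>C adj hardy_Mz (?c i *\<^sub>C (hardy_PC f + hardy_Mz g)) =
      complex_of_real (1 - \<alpha> i) *\<^sub>C g" if "i < m" for f g i
    by (rule hcoeff_eqI)
       (auto simp: hcoeff_adj_Mz hcoeff_add hcoeff_Mz hcoeff_scaleC hardy_PC_eq hcoeff_const c[OF that]
         simp del: of_real_diff)
  ultimately show ?thesis
    using assms(1,3,4) by (auto simp: X2_coordinates X2_adj_def Mz_adj_Mz intro!: eq_vecI)
qed

text \<open>Once \<open>adj T\<close> is identified with \<open>X2_adj\<close> through U, the two
  products above yield the fixed vectors of T*T, the self-commutator and, from T*T alone,
  contractivity.\<close>

lemma decomp_of_equiv_X2:
  fixes T :: "'a::chilbert_space \<Rightarrow> 'a"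
  assumes T: "bounded_clinear T" and mn: "m \<le> n" and \<alpha>: "\<alpha> ` {..<m} \<subseteq> {0<..1}"
    and eq: "equiv_X2 n m \<alpha> T"
  shows "\<exists>e \<beta>. n_finite n T \<and> self_comm_decomp n T e \<beta>"
proof -
  obtain H0 :: "'a set" and N where H0: "closed_csubspace H0" and N: "normal_contraction_on H0 N"
    and equiv: "unitarily_equivalent (subspace_ip UNIV) T (X2_space n m H0) (X2 n m \<alpha> N)"
    using eq unfolding equiv_X2_def by blast
  from equiv obtain U where U: "unitary_between U (subspace_ip UNIV) (X2_space n m H0)"
    and UT: "\<And>x. U (T x) = X2 n m \<alpha> N (U x)"
    by (auto simp: unitarily_equivalent_def car_subspace_ip)
  have N_le: "\<And>x. x \<in> H0 \<Longrightarrow> norm (N x) \<le> norm x" and N_on: "normal_on H0 N"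
    using N by (simp_all add: normal_contraction_on_def)
  then have NH0: "\<And>x. x \<in> H0 \<Longrightarrow> N x \<in> H0"
    by (auto simp: normal_on_def bounded_clinear_on_def)
  obtain S where S: "bounded_clinear_on H0 S"
    and NS: "\<And>x y. x \<in> H0 \<Longrightarrow> y \<in> H0 \<Longrightarrow> cinner (N x) y = cinner x (S y)"
    and SN: "\<And>x. x \<in> H0 \<Longrightarrow> S (N x) = N (S x)"
    using N_on unfolding normal_on_def by auto
  have SH0: "S x \<in> H0" if "x \<in> H0" for x
    using S that unfolding bounded_clinear_on_def by blast
  have zero: "0 \<in> H0"
    using H0 unfolding closed_csubspace_def complex_vector.subspace_def by blast
  have bij: "bij_betw U UNIV (car (X2_space n m H0))"
    and Ui: "\<And>x y. vinner (X2_space n m H0) (U x) (U y) = cinner x y"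
    using U by (simp_all add: unitary_between_def subspace_ip_def)
  have U_car: "\<exists>F G h. U x = (F, G, h) \<and> F \<in> carrier_vec n \<and> G \<in> carrier_vec m \<and> h \<in> H0" for x
    using bij_betw_apply[OF bij, of x] by (auto simp: car_X2_space)
  have U_surj: "\<exists>x. U x = (F, G, h)" if "F \<in> carrier_vec n" "G \<in> carrier_vec m" "h \<in> H0" for F G h
  proof -
    have "(F, G, h) \<in> range U"
      using bij_betw_imp_surj_on[OF bij] that by (simp add: car_X2_space)
    then show ?thesis
      by (auto simp: image_iff)
  qed
  \<comment> \<open>The preimage of \<open>X2_adj\<close> of U y has the same inner products with
    all x as \<open>adj T y\<close>.\<close>
  have U_adj: "U (adj T y) = X2_adj n m \<alpha> S (U y)" for y
  proof -
    obtain F' G' h' where y: "U y = (F', G', h')" "h' \<in> H0"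
      using U_car by blast
    obtain y' where y': "U y' = X2_adj n m \<alpha> S (U y)"
      using U_surj SH0[OF y(2)] by (fastforce simp: y X2_adj_def)
    have "cinner y' x = cinner (adj T y) x" for x
    proof -
      obtain F G h where x: "U x = (F, G, h)" "h \<in> H0"
        using U_car by blast
      have "cinner x (adj T y) = vinner (X2_space n m H0) (X2 n m \<alpha> N (U x)) (U y)"
        by (simp only: UT[symmetric] Ui cinner_adj[OF T, symmetric])
      also have "\<dots> = cinner x y'"
        unfolding Ui[symmetric] y' unfolding x y
        by (rule vinner_X2_X2_adj) (rule mn, rule NS[OF x(2) y(2)])
      finally show ?thesis
        using cinner_commute by metis
    qed
    then show ?thesis
      using cinner_eqI y' by metis
  qed
  define \<beta> where "\<beta> = (\<lambda>i. if i < m then \<alpha> i else 1)"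
  define \<delta> where "\<delta> = (\<lambda>i. Matrix.vec n (\<lambda>j. if j = i then hardy_const 1 else 0))"
  have "\<exists>x. U x = (\<delta> i, 0\<^sub>v m, 0)" for i
    by (rule U_surj) (simp_all add: \<delta>_def zero)
  then obtain e where e: "\<And>i. U (e i) = (\<delta> i, 0\<^sub>v m, 0)"
    by metis
  have cinner_e: "cinner x (e i) = hcoeff (vec_index F i) 0"
    if "U x = (F, G, h)" "i < n" for x F G h i
  proof -
    have "cinner x (e i) = vinner (X2_space n m H0) (F, G, h) (\<delta> i, 0\<^sub>v m, 0)"
      by (simp only: Ui[symmetric] that(1) e)
    also have "\<dots> = (\<Sum>j<n. cinner (vec_index F j) (vec_index (\<delta> i) j))"
      by (simp add: vinner_X2_space)
    also have "\<dots> = (\<Sum>j<n. if j = i then hcoeff (vec_index F i) 0 else 0)"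
      by (intro sum.cong refl) (auto simp: \<delta>_def cinner_hardy_const)
    finally have "cinner x (e i) = (\<Sum>j<n. if j = i then hcoeff (vec_index F i) 0 else 0)" .
    with that(2) show ?thesis
      by simp
  qed
  have e_orth: "orthonormal_family n e"
    unfolding orthonormal_family_def
    by (auto simp: cinner_e[OF e] \<delta>_def hcoeff_const hcoeff_zero)
  have S0: "S (N 0) = 0"
  proof -
    have "N 0 = 0"
      using N_le[OF zero] by simp
    moreover have "S (0 *\<^sub>C 0) = 0 *\<^sub>C S 0"
      using S zero unfolding bounded_clinear_on_def by blast
    ultimately show ?thesis
      by simp
  qed
  have inj: "U x = U y \<Longrightarrow> x = y" for x y
    using bij by (auto simp: bij_betw_def inj_on_def)
  have Te: "adj T (T (e i)) = e i" if "i < n" for i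
  proof (rule inj)
    have "\<delta> i \<in> carrier_vec n" "(0\<^sub>v m :: hardy Matrix.vec) \<in> carrier_vec m"
      by (simp_all add: \<delta>_def)
    then show "U (adj T (T (e i))) = U (e i)"
      by (auto simp: U_adj UT e X2_adj_X2[OF mn \<alpha>] S0 intro!: eq_vecI)
  qed
  have sc: "self_comm T = (\<lambda>h. \<Sum>j<n. complex_of_real (\<beta> j) *\<^sub>C rank_one (e j) (e j) h)"
  proof
    fix x
    show "self_comm T x = (\<Sum>j<n. complex_of_real (\<beta> j) *\<^sub>C rank_one (e j) (e j) x)"
    proof (rule cinner_eqI)
      fix y
      obtain F G h where x: "U x = (F, G, h)" "F \<in> carrier_vec n" "G \<in> carrier_vec m" "h \<in> H0"
        using U_car by blast
      obtain F' G' h' where y: "U y = (F', G', h')"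
        using U_car by blast
      have "cinner (self_comm T x) y =
          vinner (X2_space n m H0) (U (adj T (T x))) (U y) - vinner (X2_space n m H0) (U (T (adj T x))) (U y)"
        by (simp add: self_comm_def cinner_diff_left Ui)
      also have "\<dots> = (\<Sum>i<n. complex_of_real (\<beta> i) * cinner (hardy_PC (vec_index F i)) (vec_index F' i))"
        unfolding U_adj UT x(1) y X2_adj_X2[OF mn \<alpha> x(2,3)] X2_X2_adj[OF mn \<alpha> x(2,3)] vinner_X2_space
        by (simp add: SN[OF x(4)] cinner_diff_left cinner_scaleC_left sum_subtractf \<beta>_def)
      also have "\<dots> = (\<Sum>j<n. complex_of_real (\<beta> j) * (cinner x (e j) * cinner (e j) y))"
        using cinner_commute[of _ y]
        by (intro sum.cong refl) (simp add: cinner_e[OF x(1)] cinner_e[OF y] cinner_PC_left)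
      finally show "cinner (self_comm T x) y =
          cinner (\<Sum>j<n. complex_of_real (\<beta> j) *\<^sub>C rank_one (e j) (e j) x) y"
        by (simp add: cinner_sum_left rank_one_def cinner_scaleC_left mult.assoc)
    qed
  qed
  have "norm (T x) \<le> norm x" for x
  proof -
    obtain F G h where x: "U x = (F, G, h)" "F \<in> carrier_vec n" "G \<in> carrier_vec m" "h \<in> H0"
      using U_car by blast
    have "cinner h (S (N h)) = cinner (N h) (N h)"
      using NS[OF x(4) NH0[OF x(4)]] by simp
    then have Sh: "cinner (S (N h)) h = complex_of_real ((norm (N h))\<^sup>2)"
      using cinner_commute[of "S (N h)" h] by (simp add: cinner_self)
    \<comment> \<open>T*T acts diagonally in the model, with weights 1 on the first summand and 1 -
      alpha i on the second, and as S N on H0; none of these increases the norm.\<close>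
    have "complex_of_real ((norm (T x))\<^sup>2) = vinner (X2_space n m H0) (U (adj T (T x))) (U x)"
      by (simp add: Ui cinner_adj'[OF T] cinner_self)
    also have "\<dots> = complex_of_real ((\<Sum>i<n. (norm (vec_index F i))\<^sup>2) +
        (\<Sum>i<m. (1 - \<alpha> i) * (norm (vec_index G i))\<^sup>2) + (norm (N h))\<^sup>2)"
      unfolding U_adj UT x(1) X2_adj_X2[OF mn \<alpha> x(2,3)] vinner_X2_space
      by (simp add: cinner_scaleC_left cinner_self Sh)
    finally have Tx: "(norm (T x))\<^sup>2 = (\<Sum>i<n. (norm (vec_index F i))\<^sup>2) +
        (\<Sum>i<m. (1 - \<alpha> i) * (norm (vec_index G i))\<^sup>2) + (norm (N h))\<^sup>2"
      by (simp only: of_real_eq_iff)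
    have "complex_of_real ((norm x)\<^sup>2) = complex_of_real ((\<Sum>i<n. (norm (vec_index F i))\<^sup>2) +
        (\<Sum>i<m. (norm (vec_index G i))\<^sup>2) + (norm h)\<^sup>2)"
      using Ui[of x x] unfolding x(1) vinner_X2_space by (simp add: cinner_self)
    then have xx: "(norm x)\<^sup>2 = (\<Sum>i<n. (norm (vec_index F i))\<^sup>2) +
        (\<Sum>i<m. (norm (vec_index G i))\<^sup>2) + (norm h)\<^sup>2"
      by (simp only: of_real_eq_iff)
    have "(\<Sum>i<m. (1 - \<alpha> i) * (norm (vec_index G i))\<^sup>2) \<le> (\<Sum>i<m. (norm (vec_index G i))\<^sup>2)"
      using \<alpha> by (intro sum_mono mult_left_le_one_le) (auto simp: image_subset_iff intro: less_imp_le)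
    moreover have "(norm (N h))\<^sup>2 \<le> (norm h)\<^sup>2"
      by (intro power_mono N_le x) simp
    ultimately have "(norm (T x))\<^sup>2 \<le> (norm x)\<^sup>2"
      unfolding Tx xx by (intro add_mono order_refl)
    then show ?thesis
      by (simp add: power2_le_iff_abs_le)
  qed
  then have "contraction T"
    using T by (simp add: contraction_def)
  moreover have "\<beta> ` {..<n} \<subseteq> {0<..1}"
    using \<alpha> by (auto simp: \<beta>_def)
  ultimately have "n_finite n T \<and> self_comm_decomp n T e \<beta>"
    unfolding n_finite_decomp_iff using e_orth Te sc by blast
  then show ?thesis
    by blast
qed

lemma equiv_X2_of_equiv_X1:
  assumes "equiv_X1 n T"
  shows "equiv_X2 n 0 \<alpha> T"
proof -
  obtain H0 :: "'a set" and N U where H0: "closed_csubspace H0" and N: "normal_contraction_on H0 N"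
    and U: "unitary_between U (subspace_ip UNIV) (X1_space n H0)"
    and UT: "\<And>x. U (T x) = X1 n N (U x)"
    using assms by (auto simp: equiv_X1_def unitarily_equivalent_def car_subspace_ip)
  \<comment> \<open>With m = 0 the middle summand has \<open>0\<^sub>v 0\<close> as its only vector,
    so inserting it is a bijection.\<close>
  define W :: "'a \<Rightarrow> hardy Matrix.vec \<times> hardy Matrix.vec \<times> 'a" where "W = (\<lambda>x. (fst (U x), 0\<^sub>v 0, snd (U x)))"
  have bij: "bij_betw U UNIV (carrier_vec n \<times> H0)"
    using U by (simp add: unitary_between_def X1_space_def dsum_def tensor_Cn_def subspace_ip_def)
  have "bij_betw (\<lambda>(F, h). (F, 0\<^sub>v 0, h)) (carrier_vec n \<times> H0) (car (X2_space n 0 H0))"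
    by (rule bij_betw_byWitness[where f' = "\<lambda>(F, G, h). (F, h)"]) (auto simp: car_X2_space)
  from bij_betw_trans[OF bij this] have "bij_betw W UNIV (car (X2_space n 0 H0))"
    by (simp add: W_def comp_def case_prod_unfold)
  then have "unitary_between W (subspace_ip UNIV) (X2_space n 0 H0)"
    using U
    by (auto simp: unitary_between_def X1_space_def X2_space_def dsum_def tensor_Cn_def
        subspace_ip_def W_def case_prod_unfold)
  moreover have "W (T x) = X2 n 0 \<alpha> N (W x)" for x
    by (auto simp: W_def UT X1_def X2_coordinates tensor_op_one case_prod_unfold intro!: eq_vecI)
  ultimately show ?thesis
    using H0 N unfolding equiv_X2_def unitarily_equivalent_def by blast
qed

text \<open>m is the number of indices satisfying P. A bijection from the first m indices onto these
  and one from the rest onto the others are glued together.\<close>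

lemma sorting_permutation_exists:
  fixes n :: nat
  shows "\<exists>m \<sigma>. m \<le> n \<and> \<sigma> permutes {..<n} \<and> (\<forall>i<n. P (\<sigma> i) \<longleftrightarrow> i < m)"
proof -
  define A where "A = {i \<in> {..<n}. P i}"
  define m where "m = card A"
  have A: "A \<subseteq> {..<n}" "finite A"
    by (auto simp: A_def)
  have m: "m \<le> n"
    using card_mono[OF _ A(1)] by (simp add: m_def)
  obtain f where f: "bij_betw f {..<m} A"
    using finite_same_card_bij[of "{..<m}" A] A by (auto simp: m_def)
  obtain g where g: "bij_betw g {m..<n} ({..<n} - A)"
    using finite_same_card_bij[of "{m..<n}" "{..<n} - A"] A by (auto simp: m_def card_Diff_subset)
  \<comment> \<open>\<open>permutes\<close> requires the identity outside the first n
    indices.\<close>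
  define \<sigma> where "\<sigma> = (\<lambda>i. if i < m then f i else if i < n then g i else i)"
  have f': "bij_betw \<sigma> {..<m} A"
    using f by (subst bij_betw_cong[where g = f]) (simp_all add: \<sigma>_def)
  have g': "bij_betw \<sigma> {m..<n} ({..<n} - A)"
    using g by (subst bij_betw_cong[where g = g]) (simp_all add: \<sigma>_def)
  have "bij_betw \<sigma> ({..<m} \<union> {m..<n}) (A \<union> ({..<n} - A))"
    by (rule bij_betw_combine[OF f' g']) blast
  moreover have "{..<m} \<union> {m..<n} = {..<n}" "A \<union> ({..<n} - A) = {..<n}"
    using m A by auto
  ultimately have "\<sigma> permutes {..<n}"
    using m by (intro bij_imp_permutes) (auto simp: \<sigma>_def)
  moreover have "P (\<sigma> i) \<longleftrightarrow> i < m" if "i < n" for i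
  proof (cases "i < m")
    case True
    then show ?thesis
      using bij_betw_apply[OF f', of i] by (auto simp: A_def)
  next
    case False
    then show ?thesis
      using bij_betw_apply[OF g', of i] that by (auto simp: A_def)
  qed
  ultimately show ?thesis
    using m by blast
qed

text \<open>Sorting brings the weights below 1 to the positions that \<open>D_tilde_mat\<close>
  couples, while the sum for the self-commutator only has its terms permuted.\<close>

lemma equiv_X2_permuted:
  fixes T :: "'a::chilbert_space \<Rightarrow> 'a"
  assumes "n_finite n T" "self_comm_decomp n T e \<alpha>"
  shows "\<exists>m \<sigma>. m \<le> n \<and> \<sigma> permutes {..<n} \<and> equiv_X2 n m (\<alpha> \<circ> \<sigma>) T"
proof -
  obtain m \<sigma> where m: "m \<le> n" and \<sigma>: "\<sigma> permutes {..<n}" and lt: "\<forall>i<n. \<alpha> (\<sigma> i) < 1 \<longleftrightarrow> i < m"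
    using sorting_permutation_exists[of n "\<lambda>i. \<alpha> i < 1"] by blast
  have contr: "contraction T" and e: "orthonormal_family n e" and \<alpha>: "\<alpha> ` {..<n} \<subseteq> {0<..1}"
    and Te: "\<forall>i<n. adj T (T (e i)) = e i"
    and sc: "self_comm T = (\<lambda>h. \<Sum>j<n. complex_of_real (\<alpha> j) *\<^sub>C rank_one (e j) (e j) h)"
    using n_finite_decomp_iff[of n T e \<alpha>] assms by blast+
  have \<sigma>n: "\<sigma> i < n" if "i < n" for i
    using permutes_in_image[OF \<sigma>, of i] that by simp
  have "equiv_X2 n m (\<alpha> \<circ> \<sigma>) T"
  proof (rule equiv_X2_of_decomp[where e = "e \<circ> \<sigma>"])
    show "orthonormal_family n (e \<circ> \<sigma>)"
      using e \<sigma>n inj_eq[OF permutes_inj[OF \<sigma>]] by (simp add: orthonormal_family_def)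
    show "(\<alpha> \<circ> \<sigma>) ` {..<n} \<subseteq> {0<..1}"
      using \<alpha> \<sigma>n by auto
    show "self_comm T = (\<lambda>h. \<Sum>j<n. complex_of_real ((\<alpha> \<circ> \<sigma>) j) *\<^sub>C rank_one ((e \<circ> \<sigma>) j) ((e \<circ> \<sigma>) j) h)"
      unfolding sc by (subst sum.permute[OF \<sigma>]) (simp add: comp_def)
  qed (use contr Te m lt \<sigma>n in simp_all)
  with m \<sigma> show ?thesis
    by blast
qed

theorem theorem5p2:
  fixes T :: "'a::chilbert_space \<Rightarrow> 'a" and n :: nat
  assumes "separable_space (euclidean :: 'a topology)"
    and "bounded_clinear T"
  shows "((n_finite n T \<and> (\<exists>e \<alpha>. self_comm_decomp n T e \<alpha>)) \<longleftrightarrow>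
          (equiv_X1 n T \<or>
           (\<exists>m \<alpha>. m \<le> n \<and> \<alpha> ` {..<m} \<subseteq> {0<..1} \<and> equiv_X2 n m \<alpha> T))) \<and>
         (\<forall>e \<alpha>. n_finite n T \<and> self_comm_decomp n T e \<alpha> \<longrightarrow>
           equiv_X1 n T \<or>
           (\<exists>m \<sigma>. m \<le> n \<and> \<sigma> permutes {..<n} \<and> equiv_X2 n m (\<alpha> \<circ> \<sigma>) T))"
proof (intro conjI allI impI)
  show permuted: "equiv_X1 n T \<or> (\<exists>m \<sigma>. m \<le> n \<and> \<sigma> permutes {..<n} \<and> equiv_X2 n m (\<alpha> \<circ> \<sigma>) T)"
    if "n_finite n T \<and> self_comm_decomp n T e \<alpha>" for e \<alpha>
    using equiv_X2_permuted that by blast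
  show "(n_finite n T \<and> (\<exists>e \<alpha>. self_comm_decomp n T e \<alpha>)) \<longleftrightarrow>
      (equiv_X1 n T \<or> (\<exists>m \<alpha>. m \<le> n \<and> \<alpha> ` {..<m} \<subseteq> {0<..1} \<and> equiv_X2 n m \<alpha> T))"
    (is "?L \<longleftrightarrow> ?R")
  proof
    assume ?L
    then obtain e \<alpha> where e: "n_finite n T" "self_comm_decomp n T e \<alpha>"
      by blast
    then obtain m \<sigma> where m: "m \<le> n" "\<sigma> permutes {..<n}" "equiv_X2 n m (\<alpha> \<circ> \<sigma>) T"
      using equiv_X2_permuted by blast
    have "(\<alpha> \<circ> \<sigma>) ` {..<m} \<subseteq> \<alpha> ` {..<n}"
      using m(1) permutes_in_image[OF m(2)] by fastforce
    also have "\<dots> \<subseteq> {0<..1}"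
      using e(2) by (simp add: self_comm_decomp_def)
    finally show ?R
      using m by blast
  next
    assume ?R
    \<comment> \<open>The form X_1 is turned into m = 0, where the range condition on the weights is
      empty; the constant 1 is a dummy value.\<close>
    then obtain m \<alpha> where "m \<le> n" "\<alpha> ` {..<m} \<subseteq> {0<..1}" "equiv_X2 n m \<alpha> T"
      using equiv_X2_of_equiv_X1[of n T "\<lambda>_. 1"] by auto
    then show ?L
      using decomp_of_equiv_X2[OF assms(2)] by blast
  qed
qed

end
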